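(* Let $s$ and $t$ be fixed nonnegative integers with $s\le t$, and let $n\to\infty$. Then $$f(n,n-s,n-t) = (1+o(1)) \frac{\binom{n}{s}}{\binom{t}{s}}.$$
   Context: A $k$-partition of a finite set $X$ is a partition $\mathcal{P}=(X_1,\dots,X_k)$ of $X$ into precisely $k$ nonempty classes. An $r$-element set $H\subseteq X$ crosses $\mathcal{P}$ if $H$ intersects exactly $\min(r,k)$ of the classes. A hypergraph (set of subsets of $X$) crosses $\mathcal{P}$ if at least one of its members does. For integers $n\ge k$, $n\ge r$, $f(n,k,r)$ denotes the minimum number of edges of an $r$-uniform hypergraph $\mathcal{H}\subseteq\binom{X}{r}$ on an $n$-element set $X$ that crosses every $k$-partition of $X$. Here $k=n-s$ and $r=n-t$. *)

theory Defs
  imports Complex_Main "HOL-Library.Disjoint_Sets" "HOL-Library.Landau_Symbols"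
begin

definition k_partition :: "'a set \<Rightarrow> nat \<Rightarrow> 'a set set \<Rightarrow> bool" where
  "k_partition X k P \<longleftrightarrow> partition_on X P \<and> finite P \<and> card P = k"

definition edge_crosses :: "'a set \<Rightarrow> 'a set set \<Rightarrow> bool" where
  "edge_crosses H P \<longleftrightarrow> card {C \<in> P. H \<inter> C \<noteq> {}} = min (card H) (card P)"

definition crosses :: "'a set set \<Rightarrow> 'a set set \<Rightarrow> bool" where
  "crosses \<H> P \<longleftrightarrow> (\<exists>H\<in>\<H>. edge_crosses H P)"

definition uniform_hypergraph :: "'a set \<Rightarrow> nat \<Rightarrow> 'a set set \<Rightarrow> bool" where
  "uniform_hypergraph X r \<H> \<longleftrightarrow> \<H> \<subseteq> {H. H \<subseteq> X \<and> card H = r}"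

definition crossing_hypergraph :: "'a set \<Rightarrow> nat \<Rightarrow> nat \<Rightarrow> 'a set set \<Rightarrow> bool" where
  "crossing_hypergraph X k r \<H> \<longleftrightarrow>
     uniform_hypergraph X r \<H> \<and> (\<forall>P. k_partition X k P \<longrightarrow> crosses \<H> P)"

text \<open>
  The minimum is taken on the ground set \<open>{..<n}\<close>; by \<open>min_crossing_ground_set\<close> below, any
  other set with \<open>n\<close> elements gives the same value. For \<open>r \<le> n\<close> the minimum
  is attained (\<open>min_crossing_attained\<close>).
\<close>

definition min_crossing :: "nat \<Rightarrow> nat \<Rightarrow> nat \<Rightarrow> nat" where
  "min_crossing n k r = Inf {card \<H> | \<H>. crossing_hypergraph {..<n} k r \<H>}"

lemma crossing_hypergraph_image:
  assumes "finite X" and b: "bij_betw g X Y" and H: "crossing_hypergraph X k r \<H>"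
  shows "crossing_hypergraph Y k r ((`) g ` \<H>)" "card ((`) g ` \<H>) = card \<H>"
proof -
  have inj: "inj_on g X" and gX: "g ` X = Y" using b by (auto simp: bij_betw_def)
  have sub: "\<And>E. E \<in> \<H> \<Longrightarrow> E \<subseteq> X \<and> card E = r"
    using H by (auto simp: crossing_hypergraph_def uniform_hypergraph_def)
  have injH: "inj_on ((`) g) \<H>"
    by (rule inj_onI) (metis inj inj_on_image_eq_iff sub)
  show "card ((`) g ` \<H>) = card \<H>" by (rule card_image[OF injH])
  define h where "h = the_inv_into X g"
  have bh: "bij_betw h Y X" unfolding h_def by (rule bij_betw_the_inv_into[OF b])
  have injh: "inj_on h Y" and hY: "h ` Y = X" using bh by (auto simp: bij_betw_def)
  have hg: "\<And>x. x \<in> X \<Longrightarrow> h (g x) = x" unfolding h_def by (rule the_inv_into_f_f[OF inj])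
  have gh: "\<And>y. y \<in> Y \<Longrightarrow> g (h y) = y" unfolding h_def by (rule f_the_inv_into_f_bij_betw[OF b]) auto
  show "crossing_hypergraph Y k r ((`) g ` \<H>)"
    unfolding crossing_hypergraph_def
  proof (intro conjI allI impI)
    show "uniform_hypergraph Y r ((`) g ` \<H>)"
      unfolding uniform_hypergraph_def
    proof (rule subsetI)
      fix F assume "F \<in> (`) g ` \<H>"
      then obtain E where E: "E \<in> \<H>" "F = g ` E" by auto
      then show "F \<in> {H. H \<subseteq> Y \<and> card H = r}"
        using sub[OF E(1)] gX inj by (auto simp: card_image inj_on_subset)
    qed
    fix P assume P: "k_partition Y k P"
    let ?P = "(`) h ` P"
    have pP: "partition_on Y P" and fP: "finite P" and cP: "card P = k"
      using P by (auto simp: k_partition_def)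
    have CY: "\<And>C. C \<in> P \<Longrightarrow> C \<subseteq> Y" using pP by (auto simp: partition_on_def)
    have injP: "inj_on ((`) h) P" by (rule inj_onI) (metis injh inj_on_image_eq_iff CY)
    have p: "partition_on X ?P"
      unfolding partition_on_def disjoint_def
    proof (intro conjI ballI impI)
      show "\<Union> ?P = X" using pP hY by (auto simp: partition_on_def)
      show "{} \<notin> ?P" using pP by (auto simp: partition_on_def)
      fix A B assume "A \<in> ?P" "B \<in> ?P" "A \<noteq> B"
      then obtain A' B' where AB: "A' \<in> P" "A = h ` A'" "B' \<in> P" "B = h ` B'" "A' \<noteq> B'" by auto
      then have "A' \<inter> B' = {}" using pP by (auto simp: partition_on_def disjoint_def)
      then show "A \<inter> B = {}" using inj_on_image_Int[OF injh CY[OF AB(1)] CY[OF AB(3)]] AB by simp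
    qed
    then have "k_partition X k ?P"
      using fP cP injP by (auto simp: k_partition_def card_image)
    then obtain E where E: "E \<in> \<H>" and cr: "edge_crosses E ?P"
      using H by (auto simp: crossing_hypergraph_def crosses_def)
    have EX: "E \<subseteq> X" using sub[OF E] by simp
    have meet: "E \<inter> h ` C \<noteq> {} \<longleftrightarrow> g ` E \<inter> C \<noteq> {}" if C: "C \<in> P" for C
    proof
      assume "E \<inter> h ` C \<noteq> {}"
      then obtain y where "y \<in> C" "h y \<in> E" by auto
      then have "y \<in> g ` E \<inter> C" using gh[of y] CY[OF C] by (metis IntI image_eqI subsetD)
      then show "g ` E \<inter> C \<noteq> {}" by auto
    next
      assume "g ` E \<inter> C \<noteq> {}"
      then obtain x where "x \<in> E" "g x \<in> C" by auto
      then have "x \<in> E \<inter> h ` C" using hg[of x] EX by (metis IntI image_eqI subsetD)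
      then show "E \<inter> h ` C \<noteq> {}" by auto
    qed
    have eq: "{D \<in> ?P. E \<inter> D \<noteq> {}} = (`) h ` {C \<in> P. g ` E \<inter> C \<noteq> {}}"
      using meet by auto
    have "card {D \<in> ?P. E \<inter> D \<noteq> {}} = card {C \<in> P. g ` E \<inter> C \<noteq> {}}"
      unfolding eq by (rule card_image) (rule inj_on_subset[OF injP], auto)
    moreover have "card (g ` E) = card E" by (rule card_image[OF inj_on_subset[OF inj EX]])
    moreover have "card ?P = card P" by (rule card_image[OF injP])
    ultimately have "edge_crosses (g ` E) P" using cr by (simp add: edge_crosses_def)
    then show "crosses ((`) g ` \<H>) P" using E by (auto simp: crosses_def)
  qed
qed

lemma min_crossing_ground_set:
  assumes "finite X"
  shows "min_crossing (card X) k r = Inf {card \<H> | \<H>. crossing_hypergraph X k r \<H>}"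
proof -
  obtain g where g: "bij_betw g {..<card X} X"
    using ex_bij_betw_nat_finite[OF assms] by (auto simp: atLeast0LessThan)
  let ?g' = "the_inv_into {..<card X} g"
  have g': "bij_betw ?g' X {..<card X}" by (rule bij_betw_the_inv_into[OF g])
  have "{card \<H> | \<H>. crossing_hypergraph {..<card X} k r \<H>} =
        {card \<H> | \<H>. crossing_hypergraph X k r \<H>}"
    using crossing_hypergraph_image[OF finite_lessThan g, of k r]
      crossing_hypergraph_image[OF assms g', of k r]
    by (intro equalityI subsetI; clarsimp; metis)
  then show ?thesis by (simp add: min_crossing_def)
qed

lemma crossing_hypergraph_all:
  assumes fin: "finite X" and r: "r \<le> card X"
  shows "crossing_hypergraph X k r {H. H \<subseteq> X \<and> card H = r}"
  unfolding crossing_hypergraph_def uniform_hypergraph_def crosses_def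
proof (intro conjI allI impI)
  fix P assume "k_partition X k P"
  then have P: "partition_on X P" "finite P" by (auto simp: k_partition_def)
  have "\<forall>C\<in>P. \<exists>x. x \<in> C" using P(1) unfolding partition_on_def by (metis all_not_in_conv)
  then obtain c where c: "\<And>C. C \<in> P \<Longrightarrow> c C \<in> C" by metis
  have dis: "C = D" if "C \<in> P" "D \<in> P" "x \<in> C" "x \<in> D" for C D x
    using P(1) that by (auto simp: partition_on_def disjoint_def)
  have injc: "inj_on c P" by (rule inj_onI) (metis c dis)
  have cX: "c ` P \<subseteq> X" using c P(1) by (auto simp: partition_on_def)
  have cardc: "card (c ` P) = card P" by (rule card_image[OF injc])
  have "\<exists>H. H \<subseteq> X \<and> card H = r \<and> edge_crosses H P"
  proof (cases "r \<le> card P")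
    case True
    then obtain Q where Q: "Q \<subseteq> P" "card Q = r" by (metis obtain_subset_with_card_n)
    have "{C \<in> P. c ` Q \<inter> C \<noteq> {}} = Q"
      using c dis Q(1) by blast
    moreover have "card (c ` Q) = r"
      using card_image[OF inj_on_subset[OF injc Q(1)]] Q(2) by simp
    ultimately have "edge_crosses (c ` Q) P" using True Q by (simp add: edge_crosses_def)
    then show ?thesis using \<open>card (c ` Q) = r\<close> Q(1) cX by (metis image_mono order_trans)
  next
    case False
    then obtain H where H: "c ` P \<subseteq> H" "H \<subseteq> X" "card H = r"
      using exists_subset_between[of "c ` P" r X] cX fin r cardc by auto
    have "{C \<in> P. H \<inter> C \<noteq> {}} = P" using c H(1) by blast
    then have "edge_crosses H P" using False H(3) by (simp add: edge_crosses_def)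
    then show ?thesis using H by blast
  qed
  then show "\<exists>H\<in>{H. H \<subseteq> X \<and> card H = r}. edge_crosses H P" by auto
qed auto

lemma min_crossing_attained:
  assumes "r \<le> n"
  shows "\<exists>\<H>. crossing_hypergraph {..<n} k r \<H> \<and> card \<H> = min_crossing n k r"
proof -
  have "{card \<H> | \<H>. crossing_hypergraph {..<n} k r \<H>} \<noteq> {}"
    using crossing_hypergraph_all[of "{..<n}" r k] assms by auto
  from Inf_nat_def1[OF this] show ?thesis by (auto simp: min_crossing_def)
qed

end

theory Submission
  imports Defs
begin

text \<open>
  In terms of complements: for \<open>s \<le> t\<close> an edge \<open>H\<close> with \<open>n - t\<close> elements crosses a partition into \<open>n - s\<close>
  classes iff it has at most one element in each class, that is, iff its complement \<open>T\<close>, which has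
  \<open>t\<close> elements, contains all elements but at most one of every class. The sizes of the classes
  minus one add up to \<open>s\<close>, so what matters is which \<open>s\<close>-sets lie inside some complement.

  Upper bound: if every \<open>s\<close>-set lies in one of the sets \<open>T\<close>, then every partition is crossed, because
  deleting one representative from each class leaves an \<open>s\<close>-set
  (\<open>min_crossing_le_cover\<close>). Coverings of the \<open>s\<close>-sets by \<open>(1 + o(1)) (n choose s) / (t choose s)\<close>
  sets of size \<open>t\<close> exist by Roedl's theorem (\<open>roedl_covering\<close>), proved here by the nibble in the form
  of Pippenger (\<open>near_perfect_cover\<close>): a \<open>k\<close>-uniform \<open>D\<close>-regular hypergraph on \<open>N\<close> vertices whose
  codegrees are \<open>o(D)\<close> has an edge cover of size \<open>(1 + o(1)) N / k\<close>. In one round every edge is picked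
  independently with a probability of about \<open>\<epsilon> / D\<close>. About \<open>\<epsilon> N / k\<close> edges are picked, the
  fraction \<open>exp (- \<epsilon>)\<close> of the vertices stays uncovered, and since codegrees are small, the
  hypergraph on the uncovered vertices is again almost regular, of degree \<open>D exp (- \<epsilon> (k - 1))\<close>.
  The number of edges spent per vertex covered is thus \<open>\<epsilon> / (k (1 - exp (- \<epsilon>)))\<close>, which is close to
  \<open>1 / k\<close>. After a bounded number of rounds so few vertices are left that each may get an edge of its own.

  Almost regular is meant in the mean: the sum over all vertices of the deviation of the degree from
  its target is small compared to \<open>N D\<close>. With this choice first moments suffice: one weighted sum
  of the number of picked edges, the number of uncovered vertices and the squared degree deviations
  is bounded in expectation, and an outcome that does not exceed the expectation is good in all three
  respects (\<open>one_round\<close>). Every probability involved is that of a vertex set remaining uncovered,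
  which is an exact exponential in the number of edges that meet the set (\<open>survival_eq\<close>).

  Lower bound: call an \<open>s\<close>-set avoided if it lies in no complement. If for disjoint pairs
  \<open>{a\<^sub>i, b\<^sub>i}\<close> (\<open>i < s\<close>) all \<open>2 ^ s\<close> transversals were avoided, the partition into these pairs and
  singletons would not be crossed (\<open>no_box_avoids_complements\<close>). So the avoided sets contain no
  complete \<open>s\<close>-partite \<open>s\<close>-graph with parts of size two, and by a theorem of Erdos
  (\<open>complete_partite_box\<close>) there are only \<open>o(n ^ s)\<close> of them. All other \<open>s\<close>-sets lie in complements,
  each of which contains \<open>t choose s\<close>.
\<close>

section \<open>The mean over a random subset\<close>

text \<open>
  The expectation of \<open>f S\<close> for a random subset \<open>S\<close> of \<open>A\<close> that omits each element independently
  with probability \<open>q\<close>.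
\<close>

definition avg :: "real \<Rightarrow> 'a set \<Rightarrow> ('a set \<Rightarrow> real) \<Rightarrow> real" where
  "avg q A f = (\<Sum>S\<in>Pow A. (1 - q) ^ card S * q ^ card (A - S) * f S)"

text \<open>
  Expanding \<open>\<Prod>i\<in>A. x i + q\<close> with \<open>x i\<close> equal to \<open>0\<close> on \<open>B\<close> and to \<open>1 - q\<close> elsewhere produces
  exactly the weights of the subsets that miss \<open>B\<close>. The other expectations below reduce to this one.
\<close>

lemma avg_avoid:
  assumes "finite A" "B \<subseteq> A"
  shows "avg q A (\<lambda>S. of_bool (S \<inter> B = {})) = q ^ card B"
proof -
  have "avg q A (\<lambda>S. of_bool (S \<inter> B = {}))
      = (\<Sum>S\<in>Pow A. (\<Prod>i\<in>S. if i \<in> B then 0 else 1 - q) * (\<Prod>i\<in>A - S. q))"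
    unfolding avg_def
  proof (rule sum.cong[OF refl])
    fix S assume "S \<in> Pow A"
    then have fS: "finite S" using assms(1) finite_subset by auto
    show "(1 - q) ^ card S * q ^ card (A - S) * of_bool (S \<inter> B = {})
        = (\<Prod>i\<in>S. if i \<in> B then 0 else 1 - q) * (\<Prod>i\<in>A - S. q)"
    proof (cases "S \<inter> B = {}")
      case True
      then have "(\<Prod>i\<in>S. if i \<in> B then 0 else 1 - q) = (\<Prod>i\<in>S. 1 - q)"
        by (intro prod.cong) auto
      then show ?thesis using True by simp
    next
      case False
      then have "(\<Prod>i\<in>S. if i \<in> B then 0 else 1 - q) = 0"
        using fS by (intro prod_zero) auto
      then show ?thesis using False by simp
    qed
  qed
  also have "\<dots> = (\<Prod>i\<in>A. (if i \<in> B then 0 else 1 - q) + q)"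
    by (rule prod_add[OF assms(1), symmetric])
  also have "\<dots> = (\<Prod>i\<in>A. if i \<in> B then q else 1)"
    by (rule prod.cong) auto
  also have "\<dots> = q ^ card B"
    using assms by (simp add: prod.If_cases Int_absorb1 Int_absorb2)
  finally show ?thesis .
qed

lemma avg_add: "avg q A (\<lambda>S. f S + g S) = avg q A f + avg q A g"
  by (simp add: avg_def algebra_simps sum.distrib)

lemma avg_cmult: "avg q A (\<lambda>S. c * f S) = c * avg q A f"
  by (simp add: avg_def sum_distrib_left mult_ac)

lemma avg_sum: "avg q A (\<lambda>S. \<Sum>i\<in>I. f i S) = (\<Sum>i\<in>I. avg q A (f i))"
  unfolding avg_def by (simp only: sum_distrib_left) (rule sum.swap)

lemma avg_const: "finite A \<Longrightarrow> avg q A (\<lambda>S. c) = c"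
  using avg_cmult[of q A c "\<lambda>S. of_bool (S \<inter> {} = {})"] avg_avoid[of A "{}" q] by simp

lemma avg_cong: "(\<And>S. S \<subseteq> A \<Longrightarrow> f S = g S) \<Longrightarrow> avg q A f = avg q A g"
  unfolding avg_def by (intro sum.cong) auto

lemma avg_card:
  assumes "finite A"
  shows "avg q A (\<lambda>S. real (card S)) = (1 - q) * real (card A)"
proof -
  have "avg q A (\<lambda>S. real (card S)) = avg q A (\<lambda>S. \<Sum>a\<in>A. 1 + (- 1) * of_bool (S \<inter> {a} = {}))"
  proof (rule avg_cong)
    fix S assume "S \<subseteq> A"
    then have "A \<inter> S = S" by auto
    have "(\<Sum>a\<in>A. 1 + (- 1) * of_bool (S \<inter> {a} = {})) = (\<Sum>a\<in>A. if a \<in> S then 1 else (0::real))"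
      by (rule sum.cong) auto
    also have "\<dots> = real (card S)"
      using assms \<open>A \<inter> S = S\<close> by (simp add: sum.If_cases)
    finally show "real (card S) = (\<Sum>a\<in>A. 1 + (- 1) * of_bool (S \<inter> {a} = {}))" by simp
  qed
  also have "\<dots> = (\<Sum>a\<in>A. 1 + (- 1) * q ^ card {a})"
    unfolding avg_sum avg_add avg_cmult avg_const[OF assms]
    by (intro sum.cong refl arg_cong2[of _ _ _ _ "(+)"] arg_cong2[of _ _ _ _ "(*)"] avg_avoid assms) auto
  finally show ?thesis by (simp add: algebra_simps)
qed

lemma avg_attained:
  assumes A: "finite A" and q: "0 \<le> q" "q \<le> 1"
  shows "\<exists>S\<subseteq>A. f S \<le> avg q A f"
proof (rule ccontr)
  assume no: "\<not> ?thesis"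
  have less: "avg q A f < f S" if "S \<subseteq> A" for S
    using no that by (meson not_le)
  let ?w = "\<lambda>S. (1 - q) ^ card S * q ^ card (A - S)"
  define m where "m = Min (f ` Pow A)"
  have fin: "finite (f ` Pow A)" using A by simp
  have "m \<in> f ` Pow A" unfolding m_def by (rule Min_in) (use fin in auto)
  then have m: "avg q A f < m" using less by auto
  have "m = avg q A (\<lambda>S. m)" using avg_const[OF A] by simp
  also have "\<dots> \<le> avg q A f"
    unfolding avg_def
  proof (rule sum_mono)
    fix S assume S: "S \<in> Pow A"
    have "m \<le> f S" unfolding m_def using fin S by (intro Min_le) auto
    then show "?w S * m \<le> ?w S * f S" using q by (intro mult_left_mono) auto
  qed
  finally show False using m by simp
qed

section \<open>Hypergraphs with small codegrees\<close>

definition incident :: "'v set set \<Rightarrow> 'v \<Rightarrow> 'v set set" where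
  "incident E v = {e \<in> E. v \<in> e}"

definition touching :: "'v set set \<Rightarrow> 'v set \<Rightarrow> 'v set set" where
  "touching E W = {e \<in> E. e \<inter> W \<noteq> {}}"

text \<open>
  The nibble keeps the bounds \<open>D\<close> and \<open>C\<close> of the initial hypergraph throughout: passing to the edges
  inside a smaller vertex set only lowers degrees and codegrees.
\<close>

locale sparse_hypergraph =
  fixes V :: "'v set" and E :: "'v set set" and k :: nat and D C :: real
  assumes finite_V: "finite V"
    and edge: "e \<in> E \<Longrightarrow> e \<subseteq> V \<and> card e = k"
    and k_pos: "1 \<le> k" and D_pos: "0 < D" and C_nonneg: "0 \<le> C"
    and degree: "v \<in> V \<Longrightarrow> real (card (incident E v)) \<le> D"
    and codegree: "u \<in> V \<Longrightarrow> v \<in> V \<Longrightarrow> u \<noteq> v \<Longrightarrow>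
      real (card (incident E u \<inter> incident E v)) \<le> C"
begin

lemma finite_E: "finite E"
proof (rule finite_subset)
  show "E \<subseteq> Pow V" using edge by auto
qed (use finite_V in simp)

lemma finite_edge: "e \<in> E \<Longrightarrow> finite e"
  using edge finite_V finite_subset by blast

lemma finite_incident: "finite (incident E v)"
  using finite_E by (simp add: incident_def)

lemma sum_incident:
  fixes h :: "'v \<Rightarrow> 'v set \<Rightarrow> real"
  shows "(\<Sum>v\<in>V. \<Sum>e\<in>incident E v. h v e) = (\<Sum>e\<in>E. \<Sum>v\<in>e. h v e)"
proof -
  have "(\<Sum>v\<in>V. \<Sum>e\<in>incident E v. h v e) = (\<Sum>v\<in>V. \<Sum>e\<in>E. if v \<in> e then h v e else 0)"
    unfolding incident_def using finite_E by (simp add: sum.inter_filter)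
  also have "\<dots> = (\<Sum>e\<in>E. \<Sum>v\<in>V. if v \<in> e then h v e else 0)"
    by (rule sum.swap)
  also have "\<dots> = (\<Sum>e\<in>E. \<Sum>v\<in>e. h v e)"
  proof (rule sum.cong[OF refl])
    fix e assume "e \<in> E"
    then have "{v \<in> V. v \<in> e} = e" using edge by auto
    then show "(\<Sum>v\<in>V. if v \<in> e then h v e else 0) = (\<Sum>v\<in>e. h v e)"
      using sum.inter_filter[OF finite_V, of "\<lambda>v. h v e" "\<lambda>v. v \<in> e"] by simp
  qed
  finally show ?thesis .
qed

lemma sum_degree: "(\<Sum>v\<in>V. real (card (incident E v))) = real k * real (card E)"
  using sum_incident[of "\<lambda>_ _. 1"] edge by simp

text \<open>
  Counting the edges at each vertex of \<open>W\<close> counts an edge \<open>e\<close> with multiplicity \<open>card (e \<inter> W)\<close>. The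
  excess over \<open>1\<close> is at most the number of ordered pairs of distinct vertices in \<open>e \<inter> W\<close>, and each such
  pair lies in at most \<open>C\<close> edges.
\<close>

lemma card_touching:
  assumes W: "W \<subseteq> V"
  shows "real (card (touching E W)) \<le> (\<Sum>w\<in>W. real (card (incident E w)))"
    and "(\<Sum>w\<in>W. real (card (incident E w))) \<le> real (card (touching E W)) + (real (card W))\<^sup>2 * C"
proof -
  have fW: "finite W" using W finite_V finite_subset by auto
  have eq: "touching E W = (\<Union>w\<in>W. incident E w)"
    by (auto simp: touching_def incident_def)
  have "card (touching E W) \<le> (\<Sum>w\<in>W. card (incident E w))"
    unfolding eq by (rule card_UN_le[OF fW])
  then show "real (card (touching E W)) \<le> (\<Sum>w\<in>W. real (card (incident E w)))"
    by (metis of_nat_le_iff of_nat_sum)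
  have split: "(\<Sum>w\<in>W. real (card (incident E w))) = (\<Sum>e\<in>E. real (card (e \<inter> W)))" if "W \<subseteq> V" for W
  proof -
    have fW: "finite W" using that finite_V finite_subset by auto
    have "(\<Sum>w\<in>W. real (card (incident E w))) = (\<Sum>w\<in>W. \<Sum>e\<in>E. if w \<in> e then 1 else 0)"
      unfolding incident_def using finite_E by (simp add: sum.If_cases Int_def)
    also have "\<dots> = (\<Sum>e\<in>E. \<Sum>w\<in>W. if w \<in> e then 1 else 0)" by (rule sum.swap)
    also have "\<dots> = (\<Sum>e\<in>E. real (card (e \<inter> W)))"
      using fW by (simp add: sum.If_cases Int_commute)
    finally show ?thesis .
  qed
  let ?R = "W \<times> W - Id"
  have fR: "finite ?R" using fW by simp
  have pairs: "real (card (e \<inter> W)) \<le> (if e \<inter> W \<noteq> {} then 1 else 0)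
      + (\<Sum>(u,v)\<in>?R. if u \<in> e \<and> v \<in> e then 1 else 0)" if "e \<in> E" for e
  proof (cases "e \<inter> W = {}")
    case True then show ?thesis by (auto intro!: sum_nonneg split: if_splits)
  next
    case False
    then obtain u where u: "u \<in> e" "u \<in> W" by auto
    have fe: "finite (e \<inter> W)" using fW by simp
    have "real (card (e \<inter> W)) = 1 + real (card (e \<inter> W - {u}))"
      using card_Suc_Diff1[OF fe, of u] u by simp
    also have "card (e \<inter> W - {u}) = card ((\<lambda>v. (u, v)) ` (e \<inter> W - {u}))"
      by (rule card_image[symmetric]) (auto intro: inj_onI)
    also have "\<dots> \<le> card {(u,v). (u,v) \<in> ?R \<and> u \<in> e \<and> v \<in> e}"
      by (rule card_mono, rule finite_subset[OF _ fR]) (use u in \<open>auto split: if_splits\<close>)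
    also have "{(u,v). (u,v) \<in> ?R \<and> u \<in> e \<and> v \<in> e} = ?R \<inter> {(u,v). u \<in> e \<and> v \<in> e}" by auto
    also have "real (card (?R \<inter> {(u,v). u \<in> e \<and> v \<in> e}))
        = (\<Sum>p\<in>?R. if p \<in> {(u,v). u \<in> e \<and> v \<in> e} then 1 else 0)"
      using fR by (simp add: sum.If_cases)
    also have "\<dots> = (\<Sum>(u,v)\<in>?R. if u \<in> e \<and> v \<in> e then 1 else 0)"
      by (rule sum.cong) (auto split: if_splits)
    finally show ?thesis using False by simp
  qed
  have "(\<Sum>w\<in>W. real (card (incident E w))) = (\<Sum>e\<in>E. real (card (e \<inter> W)))"
    by (rule split[OF W])
  also have "\<dots> \<le> (\<Sum>e\<in>E. (if e \<inter> W \<noteq> {} then 1 else 0)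
      + (\<Sum>(u,v)\<in>?R. if u \<in> e \<and> v \<in> e then 1 else 0))"
    by (rule sum_mono) (rule pairs)
  also have "\<dots> = real (card (touching E W))
      + (\<Sum>p\<in>?R. \<Sum>e\<in>E. case p of (u,v) \<Rightarrow> if u \<in> e \<and> v \<in> e then 1 else 0)"
    unfolding sum.distrib using finite_E
    by (subst (2) sum.swap) (simp add: touching_def sum.If_cases Int_def)
  also have "(\<Sum>p\<in>?R. \<Sum>e\<in>E. case p of (u,v) \<Rightarrow> if u \<in> e \<and> v \<in> e then 1 else (0::real))
      = (\<Sum>(u,v)\<in>?R. real (card (incident E u \<inter> incident E v)))"
  proof (rule sum.cong[OF refl])
    fix p assume "p \<in> ?R"
    obtain u v where p: "p = (u,v)" by (cases p)
    have "{e \<in> E. u \<in> e \<and> v \<in> e} = incident E u \<inter> incident E v" by (auto simp: incident_def)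
    then show "(\<Sum>e\<in>E. case p of (u,v) \<Rightarrow> if u \<in> e \<and> v \<in> e then 1 else (0::real))
      = (case p of (u,v) \<Rightarrow> real (card (incident E u \<inter> incident E v)))"
      using finite_E p by (simp add: sum.If_cases Int_def)
  qed
  also have "\<dots> \<le> (\<Sum>p\<in>?R. C)"
    by (rule sum_mono) (use codegree W in auto)
  also have "\<dots> \<le> (real (card W))\<^sup>2 * C"
  proof -
    have "card ?R \<le> card (W \<times> W)" using fW by (intro card_mono) auto
    then have "real (card ?R) \<le> (real (card W))\<^sup>2"
      by (metis card_cartesian_product of_nat_le_iff of_nat_mult power2_eq_square)
    then show ?thesis using C_nonneg by (simp add: mult_right_mono)
  qed
  finally show "(\<Sum>w\<in>W. real (card (incident E w))) \<le> real (card (touching E W)) + (real (card W))\<^sup>2 * C"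
    by simp
qed

lemma induced:
  assumes "U \<subseteq> V"
  shows "sparse_hypergraph U {e \<in> E. e \<subseteq> U} k D C"
proof
  show "finite U" using assms finite_V finite_subset by auto
  fix u v assume u: "u \<in> U" 
  have "card (incident {e \<in> E. e \<subseteq> U} u) \<le> card (incident E u)"
    by (rule card_mono[OF finite_incident]) (auto simp: incident_def)
  then show "real (card (incident {e \<in> E. e \<subseteq> U} u)) \<le> D" using degree[of u] u assms by auto
  assume v: "v \<in> U" "u \<noteq> v"
  have "card (incident {e \<in> E. e \<subseteq> U} u \<inter> incident {e \<in> E. e \<subseteq> U} v) \<le> card (incident E u \<inter> incident E v)"
    by (rule card_mono) (auto simp: incident_def finite_E)
  then show "real (card (incident {e \<in> E. e \<subseteq> U} u \<inter> incident {e \<in> E. e \<subseteq> U} v)) \<le> C"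
    using codegree[of u v] u v assms by fastforce
qed (use edge k_pos D_pos C_nonneg in auto)

end

section \<open>One round of the nibble\<close>

lemma exp_minus_lipschitz:
  fixes x y :: real
  assumes "0 \<le> x" "0 \<le> y"
  shows "\<bar>exp (- x) - exp (- y)\<bar> \<le> \<bar>x - y\<bar>"
proof -
  have one_side: "exp (- u) - exp (- v) \<le> v - u" if "0 \<le> u" "u \<le> v" for u v :: real
  proof -
    have "exp (- u) - exp (- v) = exp (- u) * (1 - exp (- (v - u)))"
      by (simp add: algebra_simps flip: exp_add)
    also have "\<dots> \<le> 1 * (v - u)"
    proof (rule mult_mono)
      show "1 - exp (- (v - u)) \<le> v - u"
        using exp_ge_add_one_self[of "- (v - u)"] by linarith
    qed (use that in auto)
    finally show ?thesis by simp
  qed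
  show ?thesis
  proof (cases "x \<le> y")
    case True
    have "exp (- y) \<le> exp (- x)" using True by simp
    then show ?thesis using one_side[OF assms(1) True] True by simp
  next
    case False
    then have "exp (- x) \<le> exp (- y)" by simp
    then show ?thesis using one_side[OF assms(2), of x] False by simp
  qed
qed

text \<open>
  One round on a hypergraph whose degrees are mostly close to \<open>d * D\<close>. The omission
  probability \<open>exp (- rate)\<close> makes survival probabilities pure exponentials, with the exponent \<open>\<epsilon>\<close> for
  a single vertex of degree exactly \<open>d * D\<close>.
\<close>

locale nibble = sparse_hypergraph V E k D C
  for V :: "'v set" and E k D C +
  fixes d \<epsilon> :: real
  assumes d_pos: "0 < d" and d_le: "d \<le> 1" and eps_pos: "0 < \<epsilon>"
begin

definition rate :: real where "rate = \<epsilon> / (d * D)"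

definition dev :: "'v \<Rightarrow> real" where "dev v = \<bar>real (card (incident E v)) - d * D\<bar>"

definition survives :: "'v set \<Rightarrow> 'v set set \<Rightarrow> bool" where
  "survives W S \<longleftrightarrow> W \<inter> \<Union>S = {}"

definition survival :: "'v set \<Rightarrow> real" where
  "survival W = avg (exp (- rate)) E (\<lambda>S. of_bool (survives W S))"

definition err :: "'v set \<Rightarrow> real" where
  "err W = rate * ((\<Sum>w\<in>W. dev w) + (real (card W))\<^sup>2 * C)"

text \<open>
  The vertex \<open>v\<close> itself is exempted from surviving, so that this is a sum of survival
  indicators whether or not \<open>v\<close> is covered; for uncovered \<open>v\<close> it is the degree among the uncovered vertices.
\<close>

definition surviving_degree :: "'v \<Rightarrow> 'v set set \<Rightarrow> real" where
  "surviving_degree v S = (\<Sum>e\<in>incident E v. of_bool (survives (e - {v}) S))"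

definition decay :: real where "decay = exp (- (\<epsilon> * real (k - 1)))"

lemma rate_pos: "0 < rate" using d_pos D_pos eps_pos by (simp add: rate_def)

lemma dev_nonneg: "0 \<le> dev v" by (simp add: dev_def)

lemma survival_eq: "survival W = exp (- (rate * real (card (touching E W))))"
proof -
  have "survival W = avg (exp (- rate)) E (\<lambda>S. of_bool (S \<inter> touching E W = {}))"
    unfolding survival_def
    by (rule avg_cong) (auto simp: survives_def touching_def intro!: arg_cong[of _ _ of_bool])
  also have "\<dots> = exp (- rate) ^ card (touching E W)"
    by (rule avg_avoid[OF finite_E]) (auto simp: touching_def)
  finally show ?thesis by (simp add: exp_of_nat_mult[symmetric] mult.commute)
qed

text \<open>
  The number of edges that meet \<open>W\<close> is \<open>card W * (d * D)\<close> up to the degree deviations inside \<open>W\<close> and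
  the overlaps counted by \<open>card_touching\<close>, and \<open>exp (- x)\<close> is Lipschitz for \<open>x \<ge> 0\<close>.
\<close>

lemma survival_close:
  assumes W: "W \<subseteq> V"
  shows "\<bar>survival W - exp (- (\<epsilon> * real (card W)))\<bar> \<le> err W"
proof -
  let ?m = "real (card (touching E W))"
  have eps: "\<epsilon> * real (card W) = rate * (real (card W) * (d * D))"
    using d_pos D_pos by (simp add: rate_def)
  have "\<bar>survival W - exp (- (\<epsilon> * real (card W)))\<bar> \<le> \<bar>rate * ?m - \<epsilon> * real (card W)\<bar>"
    unfolding survival_eq using rate_pos eps_pos by (intro exp_minus_lipschitz) auto
  also have "\<dots> = rate * \<bar>?m - real (card W) * (d * D)\<bar>"
    unfolding eps using rate_pos by (simp add: abs_mult flip: right_diff_distrib)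
  also have "\<dots> \<le> err W"
    unfolding err_def
  proof (rule mult_left_mono)
    have "\<bar>(\<Sum>w\<in>W. real (card (incident E w))) - real (card W) * (d * D)\<bar>
        = \<bar>\<Sum>w\<in>W. real (card (incident E w)) - d * D\<bar>"
      by (simp add: sum_subtractf)
    also have "\<dots> \<le> (\<Sum>w\<in>W. dev w)" unfolding dev_def by (rule sum_abs)
    finally show "\<bar>?m - real (card W) * (d * D)\<bar> \<le> (\<Sum>w\<in>W. dev w) + (real (card W))\<^sup>2 * C"
      using card_touching[OF W] by linarith
  qed (use rate_pos in simp)
  finally show ?thesis .
qed

text \<open>
  A share of the error of a pair of edges that depends on one of them only, so that double sums over
  pairs of edges at a vertex split.
\<close>

definition edge_err :: "'v set \<Rightarrow> real" where
  "edge_err e = rate * ((\<Sum>w\<in>e. dev w) + 2 * (real k)\<^sup>2 * C)"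

lemma edge_err_nonneg: "0 \<le> edge_err e"
  using rate_pos C_nonneg by (auto simp: edge_err_def intro!: mult_nonneg_nonneg add_nonneg_nonneg sum_nonneg dev_nonneg)

lemma err_le:
  assumes e: "e \<in> E" "f \<in> E"
  shows "err (e \<union> f - {v}) \<le> edge_err e + edge_err f"
proof -
  let ?W = "e \<union> f - {v}"
  have fin: "finite e" "finite f" using e finite_edge by auto
  have "(\<Sum>w\<in>?W. dev w) \<le> (\<Sum>w\<in>e \<union> f. dev w)"
    using fin by (intro sum_mono2 dev_nonneg) auto
  also have "\<dots> \<le> (\<Sum>w\<in>e. dev w) + (\<Sum>w\<in>f. dev w)"
    unfolding sum_Un[OF fin] using sum_nonneg[of "e \<inter> f" dev] dev_nonneg by auto
  finally have 1: "(\<Sum>w\<in>?W. dev w) \<le> (\<Sum>w\<in>e. dev w) + (\<Sum>w\<in>f. dev w)" .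
  have "card ?W \<le> card (e \<union> f)" using fin by (intro card_mono) auto
  also have "\<dots> \<le> card e + card f" by (rule card_Un_le)
  finally have "real (card ?W) \<le> 2 * real k" using edge e by auto
  then have "(real (card ?W))\<^sup>2 \<le> (2 * real k)\<^sup>2" by (rule power_mono) simp
  then have "(real (card ?W))\<^sup>2 * C \<le> 4 * (real k)\<^sup>2 * C"
    using C_nonneg by (intro mult_right_mono) (simp_all add: power2_eq_square)
  then have "(\<Sum>w\<in>?W. dev w) + (real (card ?W))\<^sup>2 * C
      \<le> ((\<Sum>w\<in>e. dev w) + 2 * (real k)\<^sup>2 * C) + ((\<Sum>w\<in>f. dev w) + 2 * (real k)\<^sup>2 * C)"
    using 1 by linarith
  then show ?thesis
    unfolding err_def edge_err_def distrib_left[symmetric]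
    by (rule mult_left_mono) (use rate_pos in simp)
qed

lemma err_le_single:
  assumes e: "e \<in> E"
  shows "err (e - {v}) \<le> edge_err e"
proof -
  have fin: "finite e" using e finite_edge by auto
  have 1: "(\<Sum>w\<in>e - {v}. dev w) \<le> (\<Sum>w\<in>e. dev w)"
    using fin by (intro sum_mono2 dev_nonneg) auto
  have "card (e - {v}) \<le> card e" using fin by (intro card_mono) auto
  then have "real (card (e - {v})) \<le> real k" using edge e by auto
  then have "(real (card (e - {v})))\<^sup>2 \<le> (real k)\<^sup>2" by (rule power_mono) simp
  then have "(real (card (e - {v})))\<^sup>2 * C \<le> (real k)\<^sup>2 * C"
    using C_nonneg by (intro mult_right_mono)
  moreover have "0 \<le> (real k)\<^sup>2 * C" using C_nonneg by simp
  ultimately have "(\<Sum>w\<in>e - {v}. dev w) + (real (card (e - {v})))\<^sup>2 * C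
      \<le> (\<Sum>w\<in>e. dev w) + 2 * (real k)\<^sup>2 * C"
    using 1 by linarith
  then show ?thesis
    unfolding err_def edge_err_def by (rule mult_left_mono) (use rate_pos in simp)
qed

text \<open>
  An edge that meets \<open>e\<close> outside \<open>v\<close> is counted in the codegree of \<open>v\<close> and one of at most \<open>k\<close> vertices.
\<close>

lemma overlaps:
  assumes v: "v \<in> V" and e: "e \<in> incident E v"
  shows "(\<Sum>f\<in>incident E v. of_bool (e \<inter> f - {v} \<noteq> {})) \<le> real k * C"
proof -
  have eE: "e \<in> E" using e by (simp add: incident_def)
  have fe: "finite (e - {v})" using finite_edge[OF eE] by simp
  have "(\<Sum>f\<in>incident E v. of_bool (e \<inter> f - {v} \<noteq> {}))
      = real (card {f \<in> incident E v. e \<inter> f - {v} \<noteq> {}})"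
    using finite_incident by (simp add: of_bool_def sum.If_cases Int_def)
  also have "{f \<in> incident E v. e \<inter> f - {v} \<noteq> {}} = (\<Union>w\<in>e - {v}. incident E w \<inter> incident E v)"
    by (auto simp: incident_def)
  also have "real (card \<dots>) \<le> real (\<Sum>w\<in>e - {v}. card (incident E w \<inter> incident E v))"
    using card_UN_le[OF fe] by (simp only: of_nat_le_iff)
  also have "\<dots> = (\<Sum>w\<in>e - {v}. real (card (incident E w \<inter> incident E v)))" by simp
  also have "\<dots> \<le> (\<Sum>w\<in>e - {v}. C)"
    by (rule sum_mono) (use codegree v edge[OF eE] in auto)
  also have "\<dots> = real (card (e - {v})) * C" by simp
  also have "\<dots> \<le> real k * C"
    using card_Diff1_le[of e v] edge[OF eE] C_nonneg by (intro mult_right_mono) auto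
  finally show ?thesis .
qed

lemma survival_pair:
  assumes v: "v \<in> V" and e: "e \<in> incident E v" and f: "f \<in> incident E v"
  shows "survival (e \<union> f - {v})
    \<le> decay\<^sup>2 + of_bool (e \<inter> f - {v} \<noteq> {}) + (edge_err e + edge_err f)"
proof -
  let ?W = "e \<union> f - {v}"
  have E: "e \<in> E" "f \<in> E" "v \<in> e" "v \<in> f" using e f by (auto simp: incident_def)
  have W: "?W \<subseteq> V" using E edge by blast
  have "exp (- (\<epsilon> * real (card ?W))) \<le> decay\<^sup>2 + of_bool (e \<inter> f - {v} \<noteq> {})"
  proof (cases "e \<inter> f - {v} = {}")
    case True
    have "?W = (e - {v}) \<union> (f - {v})" by auto
    moreover have "(e - {v}) \<inter> (f - {v}) = {}" using True by auto
    ultimately have "card ?W = card (e - {v}) + card (f - {v})"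
      using E finite_edge by (simp add: card_Un_disjoint)
    then have "card ?W = (k - 1) + (k - 1)" using E edge finite_edge by simp
    then have "exp (- (\<epsilon> * real (card ?W))) = decay\<^sup>2"
      by (simp add: decay_def power2_eq_square algebra_simps flip: exp_add)
    then show ?thesis by simp
  next
    case False
    have "exp (- (\<epsilon> * real (card ?W))) \<le> 1" using eps_pos by simp
    then show ?thesis using False by (simp add: add_increasing)
  qed
  then show ?thesis using survival_close[OF W] err_le[OF E(1,2), of v] by linarith
qed

lemma survival_single:
  assumes v: "v \<in> V" and e: "e \<in> incident E v"
  shows "decay - edge_err e \<le> survival (e - {v})"
proof -
  have E: "e \<in> E" "v \<in> e" using e by (auto simp: incident_def)
  have W: "e - {v} \<subseteq> V" using E edge by blast
  have "card (e - {v}) = k - 1" using E edge finite_edge by simp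
  then have "exp (- (\<epsilon> * real (card (e - {v})))) = decay" by (simp add: decay_def)
  then show ?thesis using survival_close[OF W] err_le_single[OF E(1), of v] by linarith
qed

text \<open>
  The second moment method: the square of the surviving degree is a double sum over edges \<open>e\<close>, \<open>f\<close> at \<open>v\<close>
  of the indicator that \<open>e \<union> f - {v}\<close> survives. Apart from few overlapping pairs this set has
  \<open>2 * (k - 1)\<close> elements, so that its survival probability is close to \<open>decay\<^sup>2\<close>, the square of that
  of \<open>e - {v}\<close>. What remains in the main term is the square of the deviation that \<open>v\<close> had before.
\<close>

lemma avg_square_deviation:
  assumes v: "v \<in> V"
  shows "avg (exp (- rate)) E (\<lambda>S. (surviving_degree v S - decay * (d * D))\<^sup>2)
    \<le> D * dev v + real k * C * D + 4 * D * (\<Sum>e\<in>incident E v. edge_err e)"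
proof -
  let ?I = "incident E v" and ?A = "avg (exp (- rate)) E" and ?c = "decay * (d * D)"
  let ?n = "real (card ?I)" and ?H = "\<Sum>e\<in>incident E v. edge_err e"
  have H: "0 \<le> ?H" by (rule sum_nonneg) (rule edge_err_nonneg)
  have n: "0 \<le> ?n" "?n \<le> D" using degree[OF v] by auto
  have dD: "0 \<le> d * D" "d * D \<le> D" using d_pos d_le D_pos by (auto simp: mult_left_le_one_le)
  have decay: "0 \<le> decay" "decay \<le> 1" using eps_pos by (auto simp: decay_def)
  have c: "0 \<le> ?c" "?c \<le> D"
    using decay dD mult_mono[OF decay(2) dD(2)] by auto
  have sq: "(surviving_degree v S - ?c)\<^sup>2 = (\<Sum>e\<in>?I. \<Sum>f\<in>?I. of_bool (survives (e \<union> f - {v}) S))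
      + ((- 2 * ?c) * (\<Sum>e\<in>?I. of_bool (survives (e - {v}) S)) + ?c\<^sup>2)" for S
  proof -
    have "(surviving_degree v S)\<^sup>2 = (\<Sum>e\<in>?I. \<Sum>f\<in>?I. of_bool (survives (e \<union> f - {v}) S))"
      unfolding surviving_degree_def power2_eq_square sum_product
      by (intro sum.cong refl) (auto simp: survives_def)
    then show ?thesis by (simp add: power2_diff surviving_degree_def)
  qed
  have avg_eq: "?A (\<lambda>S. (surviving_degree v S - ?c)\<^sup>2) = (\<Sum>e\<in>?I. \<Sum>f\<in>?I. survival (e \<union> f - {v}))
      + ((- 2 * ?c) * (\<Sum>e\<in>?I. survival (e - {v})) + ?c\<^sup>2)"
    unfolding sq avg_add avg_sum avg_cmult avg_const[OF finite_E] survival_def ..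
  have "(\<Sum>e\<in>?I. \<Sum>f\<in>?I. survival (e \<union> f - {v}))
      \<le> (\<Sum>e\<in>?I. \<Sum>f\<in>?I. decay\<^sup>2 + of_bool (e \<inter> f - {v} \<noteq> {}) + (edge_err e + edge_err f))"
    by (intro sum_mono survival_pair[OF v])
  also have "\<dots> = ?n\<^sup>2 * decay\<^sup>2 + (\<Sum>e\<in>?I. \<Sum>f\<in>?I. of_bool (e \<inter> f - {v} \<noteq> {})) + 2 * ?n * ?H"
    by (simp add: sum.distrib power2_eq_square flip: sum_distrib_left)
  finally have pairs: "(\<Sum>e\<in>?I. \<Sum>f\<in>?I. survival (e \<union> f - {v}))
      \<le> ?n\<^sup>2 * decay\<^sup>2 + (\<Sum>e\<in>?I. \<Sum>f\<in>?I. of_bool (e \<inter> f - {v} \<noteq> {})) + 2 * ?n * ?H" .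
  have "(\<Sum>e\<in>?I. \<Sum>f\<in>?I. of_bool (e \<inter> f - {v} \<noteq> {})) \<le> (\<Sum>e\<in>?I. real k * C)"
    by (rule sum_mono) (rule overlaps[OF v])
  also have "\<dots> = ?n * (real k * C)" by simp
  also have "\<dots> \<le> D * (real k * C)"
    using n C_nonneg by (intro mult_right_mono) auto
  finally have overlap: "(\<Sum>e\<in>?I. \<Sum>f\<in>?I. of_bool (e \<inter> f - {v} \<noteq> {})) \<le> D * (real k * C)" .
  have "(\<Sum>e\<in>?I. decay - edge_err e) \<le> (\<Sum>e\<in>?I. survival (e - {v}))"
    by (intro sum_mono survival_single[OF v])
  then have "?n * decay - ?H \<le> (\<Sum>e\<in>?I. survival (e - {v}))"
    by (simp add: sum_subtractf)
  then have singles: "(- 2 * ?c) * (\<Sum>e\<in>?I. survival (e - {v})) \<le> (- 2 * ?c) * (?n * decay - ?H)"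
    using c by (intro mult_left_mono_neg) auto
  have square: "?n\<^sup>2 * decay\<^sup>2 + ((- 2 * ?c) * (?n * decay - ?H) + ?c\<^sup>2)
      = decay\<^sup>2 * (?n - d * D)\<^sup>2 + 2 * ?c * ?H"
    by algebra
  \<comment> \<open>Both \<open>?n\<close> and \<open>d * D\<close> lie between \<open>0\<close> and \<open>D\<close>, so one factor of the square can be given away.\<close>
  have main: "decay\<^sup>2 * (?n - d * D)\<^sup>2 \<le> 1 * (D * dev v)"
  proof (rule mult_mono)
    show "decay\<^sup>2 \<le> 1" using decay by (simp add: power_le_one)
    have "\<bar>?n - d * D\<bar> \<le> D" using n dD by linarith
    then show "(?n - d * D)\<^sup>2 \<le> D * dev v"
      unfolding dev_def power2_eq_square
      by (metis abs_ge_zero abs_mult_self_eq mult_right_mono)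
  qed auto
  have nH: "2 * ?n * ?H \<le> 2 * D * ?H" using n H by (intro mult_right_mono) auto
  have cH: "2 * ?c * ?H \<le> 2 * D * ?H" using c H by (intro mult_right_mono) auto
  have "real k * C * D = D * (real k * C)" by simp
  then show ?thesis
    unfolding avg_eq using pairs overlap singles square main nH cH by linarith
qed

text \<open>
  Summed over all vertices, the edge errors at \<open>v\<close> count the deviation of each vertex at most \<open>k * D\<close> times.
  This is how an \<open>L\<^sup>1\<close> bound on the old deviations controls the \<open>L\<^sup>2\<close> norm of the new ones.
\<close>

lemma avg_total_square_deviation:
  "avg (exp (- rate)) E (\<lambda>S. \<Sum>v\<in>V. (surviving_degree v S - decay * (d * D))\<^sup>2)
    \<le> D * (\<Sum>v\<in>V. dev v) + real k * C * D * real (card V)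
      + 4 * real k * (\<epsilon> / d) * (D * (\<Sum>v\<in>V. dev v) + 2 * (real k)\<^sup>2 * C * D * real (card V))"
proof -
  let ?\<Delta> = "\<Sum>v\<in>V. dev v" and ?N = "real (card V)"
  have card_E: "real (card E) \<le> D * ?N"
  proof -
    have "1 * real (card E) \<le> real k * real (card E)" using k_pos by (intro mult_right_mono) auto
    also have "\<dots> = (\<Sum>v\<in>V. real (card (incident E v)))" by (rule sum_degree[symmetric])
    also have "\<dots> \<le> (\<Sum>v\<in>V. D)" by (rule sum_mono) (rule degree)
    finally show ?thesis by (simp add: mult.commute)
  qed
  have "(\<Sum>v\<in>V. \<Sum>e\<in>incident E v. edge_err e) = (\<Sum>e\<in>E. \<Sum>v\<in>e. edge_err e)"
    by (rule sum_incident)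
  also have "\<dots> = real k * (\<Sum>e\<in>E. edge_err e)"
    using edge by (simp add: sum_distrib_left)
  also have "(\<Sum>e\<in>E. edge_err e) = rate * ((\<Sum>e\<in>E. \<Sum>w\<in>e. dev w) + 2 * (real k)\<^sup>2 * C * real (card E))"
    unfolding edge_err_def by (simp add: sum.distrib flip: sum_distrib_left)
  also have "(\<Sum>e\<in>E. \<Sum>w\<in>e. dev w) = (\<Sum>w\<in>V. \<Sum>e\<in>incident E w. dev w)"
    by (rule sum_incident[symmetric])
  also have "\<dots> = (\<Sum>w\<in>V. real (card (incident E w)) * dev w)" by simp
  finally have eq: "(\<Sum>v\<in>V. \<Sum>e\<in>incident E v. edge_err e)
      = real k * (rate * ((\<Sum>w\<in>V. real (card (incident E w)) * dev w)
          + 2 * (real k)\<^sup>2 * C * real (card E)))" .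
  have 1: "(\<Sum>w\<in>V. real (card (incident E w)) * dev w) \<le> D * ?\<Delta>"
    unfolding sum_distrib_left
    by (rule sum_mono) (rule mult_right_mono[OF degree dev_nonneg])
  have 2: "2 * (real k)\<^sup>2 * C * real (card E) \<le> 2 * (real k)\<^sup>2 * C * (D * ?N)"
    by (rule mult_left_mono[OF card_E]) (use C_nonneg in simp)
  have "(\<Sum>v\<in>V. \<Sum>e\<in>incident E v. edge_err e)
      \<le> real k * (rate * (D * ?\<Delta> + 2 * (real k)\<^sup>2 * C * (D * ?N)))"
    unfolding eq using rate_pos by (intro mult_left_mono add_mono 1 2) auto
  then have "4 * D * (\<Sum>v\<in>V. \<Sum>e\<in>incident E v. edge_err e)
      \<le> 4 * D * (real k * (rate * (D * ?\<Delta> + 2 * (real k)\<^sup>2 * C * (D * ?N))))"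
    using D_pos by (intro mult_left_mono) auto
  also have "\<dots> = 4 * real k * (D * rate) * (D * ?\<Delta> + 2 * (real k)\<^sup>2 * C * D * ?N)"
    by (simp add: algebra_simps)
  also have "D * rate = \<epsilon> / d" using D_pos by (simp add: rate_def)
  finally have 3: "4 * D * (\<Sum>v\<in>V. \<Sum>e\<in>incident E v. edge_err e)
      \<le> 4 * real k * (\<epsilon> / d) * (D * ?\<Delta> + 2 * (real k)\<^sup>2 * C * D * ?N)" .
  have "avg (exp (- rate)) E (\<lambda>S. \<Sum>v\<in>V. (surviving_degree v S - decay * (d * D))\<^sup>2)
      \<le> (\<Sum>v\<in>V. D * dev v + real k * C * D + 4 * D * (\<Sum>e\<in>incident E v. edge_err e))"
    unfolding avg_sum by (intro sum_mono avg_square_deviation)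
  also have "\<dots> = D * ?\<Delta> + real k * C * D * ?N + 4 * D * (\<Sum>v\<in>V. \<Sum>e\<in>incident E v. edge_err e)"
    by (simp add: sum.distrib algebra_simps flip: sum_distrib_left)
  finally show ?thesis using 3 by linarith
qed

lemma avg_card_chosen:
  "avg (exp (- rate)) E (\<lambda>S. real (card S))
    \<le> \<epsilon> / real k * real (card V) + \<epsilon> / (d * D) * (\<Sum>v\<in>V. dev v)"
proof -
  have "real k * real (card E) = (\<Sum>v\<in>V. real (card (incident E v)))"
    by (rule sum_degree[symmetric])
  also have "\<dots> \<le> (\<Sum>v\<in>V. d * D + dev v)"
    by (rule sum_mono) (simp add: dev_def)
  finally have kE: "real k * real (card E) \<le> real (card V) * (d * D) + (\<Sum>v\<in>V. dev v)"
    by (simp add: sum.distrib)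
  have "avg (exp (- rate)) E (\<lambda>S. real (card S)) \<le> rate * real (card E)"
    unfolding avg_card[OF finite_E] using exp_ge_add_one_self[of "- rate"]
    by (intro mult_right_mono) auto
  also have "\<dots> = rate / real k * (real k * real (card E))" using k_pos by simp
  also have "\<dots> \<le> rate / real k * (real (card V) * (d * D) + (\<Sum>v\<in>V. dev v))"
    using rate_pos by (intro mult_left_mono[OF kE]) simp
  also have "\<dots> = \<epsilon> / real k * real (card V) + rate / real k * (\<Sum>v\<in>V. dev v)"
    using d_pos D_pos by (simp add: rate_def distrib_left)
  also have "rate / real k * (\<Sum>v\<in>V. dev v) \<le> rate * (\<Sum>v\<in>V. dev v)"
    using rate_pos k_pos
    by (intro mult_right_mono sum_nonneg dev_nonneg) (simp add: divide_le_eq)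
  finally show ?thesis by (simp add: rate_def)
qed

lemma avg_card_uncovered:
  "avg (exp (- rate)) E (\<lambda>S. real (card (V - \<Union>S)))
    \<le> exp (- \<epsilon>) * real (card V) + \<epsilon> / (d * D) * ((\<Sum>v\<in>V. dev v) + C * real (card V))"
proof -
  have "avg (exp (- rate)) E (\<lambda>S. real (card (V - \<Union>S)))
      = avg (exp (- rate)) E (\<lambda>S. \<Sum>v\<in>V. of_bool (survives {v} S))"
  proof (rule avg_cong)
    fix S assume "S \<subseteq> E"
    have "V - \<Union>S = {v \<in> V. survives {v} S}" by (auto simp: survives_def)
    then show "real (card (V - \<Union>S)) = (\<Sum>v\<in>V. of_bool (survives {v} S))"
      using finite_V by (simp add: of_bool_def sum.If_cases Int_def)
  qed
  also have "\<dots> = (\<Sum>v\<in>V. survival {v})" by (simp add: avg_sum survival_def)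
  also have "\<dots> \<le> (\<Sum>v\<in>V. exp (- \<epsilon>) + rate * (dev v + C))"
  proof (rule sum_mono)
    fix v assume "v \<in> V"
    then show "survival {v} \<le> exp (- \<epsilon>) + rate * (dev v + C)"
      using survival_close[of "{v}"] by (simp add: err_def)
  qed
  also have "\<dots> = exp (- \<epsilon>) * real (card V) + rate * ((\<Sum>v\<in>V. dev v) + C * real (card V))"
    by (simp add: sum.distrib algebra_simps flip: sum_distrib_left)
  finally show ?thesis by (simp add: rate_def)
qed

text \<open>
  An outcome at or below the expectation of the weighted sum. The weight \<open>a\<close> is the price of covering one
  remaining vertex in later rounds, and a large \<open>\<kappa>\<close> forces the new degrees to be concentrated, at a
  cost that a small \<open>\<delta>\<close> compensates.
\<close>

lemma one_round:
  fixes \<delta> N a \<kappa> :: real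
  assumes N: "real (card V) \<le> N" and dev: "(\<Sum>v\<in>V. dev v) \<le> \<delta> * N * D" and C: "C \<le> \<delta> * D"
    and nonneg: "0 \<le> \<delta>" "0 \<le> a" "0 \<le> \<kappa>"
  shows "\<exists>S\<subseteq>E. real (card S) + a * real (card (V - \<Union>S))
      + \<kappa> / D\<^sup>2 * (\<Sum>v\<in>V. (surviving_degree v S - decay * (d * D))\<^sup>2)
    \<le> (\<epsilon> / real k + exp (- \<epsilon>) * a) * real (card V)
      + \<delta> * N * (\<epsilon> / d * (1 + 2 * a)
          + \<kappa> * (1 + real k + 4 * real k * (\<epsilon> / d) * (1 + 2 * (real k)\<^sup>2)))"
proof -
  let ?A = "avg (exp (- rate)) E" and ?n = "real (card V)" and ?\<Delta> = "\<Sum>v\<in>V. dev v"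
  let ?\<Phi> = "\<lambda>S. \<Sum>v\<in>V. (surviving_degree v S - decay * (d * D))\<^sup>2"
  \<comment> \<open>Ring identities over variables, so that the fractions below are treated as atoms.\<close>
  have ident1: "D\<^sup>2 * (x * (1 + k + 4 * k * r * (1 + 2 * K)))
      = D * (x * D) + k * D * (x * D) + 4 * k * r * (D * (x * D) + 2 * K * D * (x * D))"
    for D x k r K :: real by algebra
  have ident2: "(u * n + x * r) + a * (w * n + x * (2 * r)) + x * z
      = (u + w * a) * n + x * (r * (1 + 2 * a) + z)" for u n x r a w z :: real
    by algebra
  have ed: "0 \<le> \<epsilon> / d" "0 \<le> \<epsilon> / (d * D)" using eps_pos d_pos D_pos by auto
  have CN: "C * ?n \<le> \<delta> * N * D"
    using mult_mono[OF C N] nonneg D_pos by (simp add: mult_ac)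
  have chosen: "?A (\<lambda>S. real (card S)) \<le> \<epsilon> / real k * ?n + \<delta> * N * (\<epsilon> / d)"
  proof -
    have "\<epsilon> / (d * D) * ?\<Delta> \<le> \<epsilon> / (d * D) * (\<delta> * N * D)" by (rule mult_left_mono[OF dev ed(2)])
    also have "\<dots> = \<delta> * N * (\<epsilon> / d)" using D_pos by simp
    finally show ?thesis using avg_card_chosen by linarith
  qed
  have "?A (\<lambda>S. real (card (V - \<Union>S))) \<le> exp (- \<epsilon>) * ?n + \<delta> * N * (2 * (\<epsilon> / d))"
  proof -
    have "\<epsilon> / (d * D) * (?\<Delta> + C * ?n) \<le> \<epsilon> / (d * D) * (\<delta> * N * D + \<delta> * N * D)"
      by (rule mult_left_mono[OF add_mono[OF dev CN] ed(2)])
    also have "\<dots> = \<delta> * N * (2 * (\<epsilon> / d))" using D_pos by (simp add: field_simps)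
    finally show ?thesis using avg_card_uncovered by linarith
  qed
  then have uncovered: "a * ?A (\<lambda>S. real (card (V - \<Union>S)))
      \<le> a * (exp (- \<epsilon>) * ?n + \<delta> * N * (2 * (\<epsilon> / d)))"
    using nonneg by (intro mult_left_mono)
  have "?A ?\<Phi> \<le> D\<^sup>2 * (\<delta> * N * (1 + real k + 4 * real k * (\<epsilon> / d) * (1 + 2 * (real k)\<^sup>2)))"
  proof -
    have 1: "D * ?\<Delta> \<le> D * (\<delta> * N * D)" using D_pos by (intro mult_left_mono[OF dev]) simp
    have 2: "real k * C * D * ?n \<le> real k * D * (\<delta> * N * D)"
    proof -
      have "real k * C * D * ?n = real k * D * (C * ?n)" by simp
      also have "\<dots> \<le> real k * D * (\<delta> * N * D)" using D_pos by (intro mult_left_mono[OF CN]) simp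
      finally show ?thesis .
    qed
    have 3: "2 * (real k)\<^sup>2 * C * D * ?n \<le> 2 * (real k)\<^sup>2 * D * (\<delta> * N * D)"
    proof -
      have "2 * (real k)\<^sup>2 * C * D * ?n = 2 * (real k)\<^sup>2 * D * (C * ?n)" by simp
      also have "\<dots> \<le> 2 * (real k)\<^sup>2 * D * (\<delta> * N * D)"
        using D_pos by (intro mult_left_mono[OF CN]) simp
      finally show ?thesis .
    qed
    have 4: "4 * real k * (\<epsilon> / d) * (D * ?\<Delta> + 2 * (real k)\<^sup>2 * C * D * ?n)
        \<le> 4 * real k * (\<epsilon> / d) * (D * (\<delta> * N * D) + 2 * (real k)\<^sup>2 * D * (\<delta> * N * D))"
      by (rule mult_left_mono[OF add_mono[OF 1 3]]) (intro mult_nonneg_nonneg ed, simp_all)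
    have "D\<^sup>2 * (\<delta> * N * (1 + real k + 4 * real k * (\<epsilon> / d) * (1 + 2 * (real k)\<^sup>2)))
      = D * (\<delta> * N * D) + real k * D * (\<delta> * N * D)
       + 4 * real k * (\<epsilon> / d) * (D * (\<delta> * N * D) + 2 * (real k)\<^sup>2 * D * (\<delta> * N * D))"
      by (rule ident1)
    then show ?thesis
      using avg_total_square_deviation 1 2 4 by linarith
  qed
  then have "\<kappa> / D\<^sup>2 * ?A ?\<Phi>
      \<le> \<kappa> / D\<^sup>2 * (D\<^sup>2 * (\<delta> * N * (1 + real k + 4 * real k * (\<epsilon> / d) * (1 + 2 * (real k)\<^sup>2))))"
    using nonneg by (intro mult_left_mono) auto
  also have "\<dots> = \<delta> * N * (\<kappa> * (1 + real k + 4 * real k * (\<epsilon> / d) * (1 + 2 * (real k)\<^sup>2)))"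
    using D_pos by simp
  finally have square: "\<kappa> / D\<^sup>2 * ?A ?\<Phi> \<le> \<dots>" .
  obtain S where S: "S \<subseteq> E" "real (card S) + a * real (card (V - \<Union>S)) + \<kappa> / D\<^sup>2 * ?\<Phi> S
      \<le> ?A (\<lambda>S. real (card S) + a * real (card (V - \<Union>S)) + \<kappa> / D\<^sup>2 * ?\<Phi> S)"
    using avg_attained[OF finite_E, of "exp (- rate)"
        "\<lambda>S. real (card S) + a * real (card (V - \<Union>S)) + \<kappa> / D\<^sup>2 * ?\<Phi> S"] rate_pos by auto
  note S(2)
  also have "?A (\<lambda>S. real (card S) + a * real (card (V - \<Union>S)) + \<kappa> / D\<^sup>2 * ?\<Phi> S)
      = ?A (\<lambda>S. real (card S)) + a * ?A (\<lambda>S. real (card (V - \<Union>S))) + \<kappa> / D\<^sup>2 * ?A ?\<Phi>"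
    by (simp only: avg_add avg_cmult)
  also have "\<dots> \<le> (\<epsilon> / real k * ?n + \<delta> * N * (\<epsilon> / d)) + a * (exp (- \<epsilon>) * ?n + \<delta> * N * (2 * (\<epsilon> / d)))
      + \<delta> * N * (\<kappa> * (1 + real k + 4 * real k * (\<epsilon> / d) * (1 + 2 * (real k)\<^sup>2)))"
    by (intro add_mono chosen uncovered square)
  also have "\<dots> = (\<epsilon> / real k + exp (- \<epsilon>) * a) * ?n
      + \<delta> * N * (\<epsilon> / d * (1 + 2 * a)
          + \<kappa> * (1 + real k + 4 * real k * (\<epsilon> / d) * (1 + 2 * (real k)\<^sup>2)))"
    by (rule ident2)
  finally show ?thesis using S(1) by blast
qed

text \<open>
  From the squared back to the absolute deviations, through \<open>\<bar>x\<bar> \<le> x\<^sup>2 / c + c\<close> with \<open>c = \<eta> * D\<close>.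
\<close>

lemma deviation_of_survivors:
  fixes \<eta> :: real
  assumes S: "S \<subseteq> E" and \<eta>: "0 < \<eta>"
  shows "(\<Sum>v\<in>V - \<Union>S. \<bar>real (card (incident {e \<in> E. e \<subseteq> V - \<Union>S} v)) - decay * (d * D)\<bar>)
    \<le> (\<Sum>v\<in>V. (surviving_degree v S - decay * (d * D))\<^sup>2) / (\<eta> * D) + \<eta> * D * real (card V)"
proof -
  let ?c = "decay * (d * D)"
  have eq: "real (card (incident {e \<in> E. e \<subseteq> V - \<Union>S} v)) = surviving_degree v S" if v: "v \<in> V - \<Union>S" for v
  proof -
    have "incident {e \<in> E. e \<subseteq> V - \<Union>S} v = {e \<in> incident E v. survives (e - {v}) S}"
    proof -
      have "e \<subseteq> V - \<Union>S \<longleftrightarrow> survives (e - {v}) S" if "e \<in> E" for e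
        using edge[OF that] v by (auto simp: survives_def)
      then show ?thesis by (auto simp: incident_def)
    qed
    then show ?thesis
      unfolding surviving_degree_def using finite_incident by (simp add: of_bool_def sum.If_cases Int_def)
  qed
  have am_gm: "\<bar>x\<bar> \<le> x\<^sup>2 / (\<eta> * D) + \<eta> * D" for x
  proof -
    have pos: "0 < \<eta> * D" using \<eta> D_pos by simp
    have "\<bar>x\<bar> * (\<eta> * D) \<le> x\<^sup>2 + (\<eta> * D)\<^sup>2"
    proof -
      have "0 \<le> \<bar>x\<bar> * (\<eta> * D)" using pos by simp
      moreover have "2 * (\<bar>x\<bar> * (\<eta> * D)) \<le> x\<^sup>2 + (\<eta> * D)\<^sup>2"
        using sum_squares_bound[of "\<bar>x\<bar>" "\<eta> * D"] by (simp only: power2_abs mult.assoc)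
      ultimately show ?thesis by linarith
    qed
    then show ?thesis using pos \<eta> D_pos by (simp add: field_simps power2_eq_square)
  qed
  have "(\<Sum>v\<in>V - \<Union>S. \<bar>real (card (incident {e \<in> E. e \<subseteq> V - \<Union>S} v)) - ?c\<bar>)
      = (\<Sum>v\<in>V - \<Union>S. \<bar>surviving_degree v S - ?c\<bar>)"
    by (rule sum.cong) (simp_all add: eq)
  also have "\<dots> \<le> (\<Sum>v\<in>V. \<bar>surviving_degree v S - ?c\<bar>)"
    using finite_V by (intro sum_mono2) auto
  also have "\<dots> \<le> (\<Sum>v\<in>V. (surviving_degree v S - ?c)\<^sup>2 / (\<eta> * D) + \<eta> * D)"
    by (rule sum_mono) (rule am_gm)
  finally show ?thesis by (simp add: sum.distrib sum_divide_distrib mult.commute)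
qed

end

section \<open>Iterating the nibble\<close>

text \<open>
  The number of edges spent per vertex when \<open>j\<close> rounds are played and each vertex that then remains gets an edge
  of its own.
\<close>

fun budget :: "real \<Rightarrow> nat \<Rightarrow> nat \<Rightarrow> real" where
  "budget \<epsilon> k 0 = 1"
| "budget \<epsilon> k (Suc j) = \<epsilon> / real k + exp (- \<epsilon>) * budget \<epsilon> k j"

lemma budget_nonneg: "0 \<le> \<epsilon> \<Longrightarrow> 0 \<le> budget \<epsilon> k j"
  by (induction j) auto

text \<open>
  The recursion contracts towards its fixed point \<open>\<epsilon> / (k * (1 - exp (- \<epsilon>)))\<close>, which is at most
  \<open>(1 + \<epsilon>) / k\<close> because \<open>1 + \<epsilon> \<le> exp \<epsilon>\<close>.
\<close>

lemma budget_le: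
  assumes "0 < \<epsilon>" "1 \<le> k"
  shows "budget \<epsilon> k j \<le> (1 + \<epsilon>) / real k + exp (- (\<epsilon> * real j))"
proof (induction j)
  case 0
  then show ?case using assms by simp
next
  case (Suc j)
  have "exp (- \<epsilon>) * (1 + \<epsilon>) \<le> exp (- \<epsilon>) * exp \<epsilon>"
    by (rule mult_left_mono) (use exp_ge_add_one_self[of \<epsilon>] in auto)
  then have "exp (- \<epsilon>) * (1 + \<epsilon>) \<le> 1" by (simp flip: exp_add)
  then have 1: "exp (- \<epsilon>) * ((1 + \<epsilon>) / real k) \<le> 1 / real k"
    using assms by (simp add: divide_right_mono)
  have "budget \<epsilon> k (Suc j) \<le> \<epsilon> / real k + exp (- \<epsilon>) * ((1 + \<epsilon>) / real k + exp (- (\<epsilon> * real j)))"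
    using Suc by simp
  also have "\<dots> = \<epsilon> / real k + exp (- \<epsilon>) * ((1 + \<epsilon>) / real k) + exp (- (\<epsilon> * real (Suc j)))"
    by (simp add: algebra_simps flip: exp_add)
  also have "\<dots> \<le> \<epsilon> / real k + 1 / real k + exp (- (\<epsilon> * real (Suc j)))"
    using 1 by simp
  finally show ?case by (simp add: add_divide_distrib)
qed

text \<open>
  Induction on the number of rounds. The tolerance \<open>\<delta>\<close> for \<open>j + 1\<close> rounds is chosen after the
  tolerance \<open>\<delta>'\<close> that the remaining \<open>j\<close> rounds need. The ambient vertex set \<open>V\<close> stays fixed and serves as
  the unit in which all errors are measured, while \<open>U\<close> shrinks.
\<close>

lemma nibble_cover:
  fixes \<epsilon> :: real and k :: nat
  assumes eps: "0 < \<epsilon>" and k: "1 \<le> k" and "0 < d" "d \<le> 1" "0 < \<gamma>"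
  shows "\<exists>\<delta>>0. \<forall>(V :: 'v set) E D C U.
    sparse_hypergraph V E k D C \<and> V \<subseteq> \<Union>E \<and> C \<le> \<delta> * D \<and> U \<subseteq> V \<and>
    (\<Sum>v\<in>U. \<bar>real (card (incident {e \<in> E. e \<subseteq> U} v)) - d * D\<bar>) \<le> \<delta> * real (card V) * D
    \<longrightarrow> (\<exists>F\<subseteq>E. U \<subseteq> \<Union>F \<and>
      real (card F) \<le> budget \<epsilon> k j * real (card U) + \<gamma> * real (card V))"
  using assms(3-5)
proof (induction j arbitrary: d \<gamma>)
  case 0
  have "\<exists>F\<subseteq>E. U \<subseteq> \<Union>F \<and> real (card F) \<le> budget \<epsilon> k 0 * real (card U) + \<gamma> * real (card V)"
    if H: "sparse_hypergraph V E k D C" and cov: "V \<subseteq> \<Union>E" and U: "U \<subseteq> V"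
    for V U :: "'v set" and E D C
  proof -
    have "\<forall>v\<in>U. \<exists>e. e \<in> E \<and> v \<in> e" using cov U by blast
    then obtain p where p: "\<And>v. v \<in> U \<Longrightarrow> p v \<in> E \<and> v \<in> p v" by metis
    have "finite U" using U sparse_hypergraph.finite_V[OF H] finite_subset by auto
    then have "real (card (p ` U)) \<le> real (card U)" using card_image_le by auto
    then have "real (card (p ` U)) \<le> budget \<epsilon> k 0 * real (card U) + \<gamma> * real (card V)"
      using 0 by (simp add: add_increasing2)
    moreover have "p ` U \<subseteq> E" "U \<subseteq> \<Union>(p ` U)" using p by auto
    ultimately show ?thesis by blast
  qed
  then show ?case by (intro exI[of _ 1]) auto
next
  case (Suc j)
  define d' where "d' = exp (- (\<epsilon> * real (k - 1))) * d"
  have decay1: "exp (- (\<epsilon> * real (k - 1))) \<le> 1" using eps by simp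
  have d': "0 < d'" "d' \<le> 1"
    using Suc.prems mult_le_one[OF decay1, of d] by (simp_all add: d'_def)
  have "0 < \<gamma> / 2" using Suc.prems by simp
  from Suc.IH[OF d' this] obtain \<delta>' where \<delta>': "0 < \<delta>'" and IH:
    "\<forall>(V :: 'v set) E D C U. sparse_hypergraph V E k D C \<and> V \<subseteq> \<Union>E \<and> C \<le> \<delta>' * D \<and> U \<subseteq> V \<and>
      (\<Sum>v\<in>U. \<bar>real (card (incident {e \<in> E. e \<subseteq> U} v)) - d' * D\<bar>) \<le> \<delta>' * real (card V) * D
      \<longrightarrow> (\<exists>F\<subseteq>E. U \<subseteq> \<Union>F \<and>
        real (card F) \<le> budget \<epsilon> k j * real (card U) + \<gamma> / 2 * real (card V))"
    by (elim exE conjE) (rule that)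
  define a where "a = budget \<epsilon> k j"
  define a' where "a' = budget \<epsilon> k (Suc j)"
  have a: "0 \<le> a" "0 \<le> a'" and a'_eq: "a' = \<epsilon> / real k + exp (- \<epsilon>) * a"
    using budget_nonneg eps by (auto simp: a_def a'_def less_imp_le)
  \<comment> \<open>With this weight a total of at most \<open>(a' + 1) * card V\<close> forces the squared deviations below
    \<open>(\<delta>' / 2)\<^sup>2 * card V * D\<^sup>2\<close>.\<close>
  define \<kappa> where "\<kappa> = 4 * (a' + 1) / \<delta>'\<^sup>2"
  define K where "K = \<epsilon> / d * (1 + 2 * a)
    + \<kappa> * (1 + real k + 4 * real k * (\<epsilon> / d) * (1 + 2 * (real k)\<^sup>2))"
  define \<mu> where "\<mu> = min 1 (\<gamma> / 2)"
  define \<delta> where "\<delta> = min \<delta>' (\<mu> / (K + 1))"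
  have \<kappa>: "0 < \<kappa>" using a \<delta>' by (auto simp: \<kappa>_def)
  have K: "0 \<le> K"
    unfolding K_def using \<kappa> a eps Suc.prems
    by (intro add_nonneg_nonneg mult_nonneg_nonneg) auto
  have \<mu>: "0 < \<mu>" "\<mu> \<le> 1" "\<mu> \<le> \<gamma> / 2" using Suc.prems by (auto simp: \<mu>_def)
  have \<delta>: "0 < \<delta>" "\<delta> \<le> \<delta>'" using \<delta>' \<mu> K by (auto simp: \<delta>_def)
  have \<delta>K: "\<delta> * K \<le> \<mu>"
  proof -
    have "\<delta> * K \<le> \<mu> / (K + 1) * K" unfolding \<delta>_def using K by (intro mult_right_mono) auto
    also have "\<dots> \<le> \<mu>" using K \<mu> by (simp add: field_simps)
    finally show ?thesis .
  qed
  have step: "\<exists>F\<subseteq>E. U \<subseteq> \<Union>F \<and> real (card F) \<le> budget \<epsilon> k (Suc j) * real (card U) + \<gamma> * real (card V)"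
    if H: "sparse_hypergraph V E k D C" and cov: "V \<subseteq> \<Union>E" and C: "C \<le> \<delta> * D" and U: "U \<subseteq> V"
      and dev: "(\<Sum>v\<in>U. \<bar>real (card (incident {e \<in> E. e \<subseteq> U} v)) - d * D\<bar>) \<le> \<delta> * real (card V) * D"
    for V U :: "'v set" and E D C
  proof -
    let ?E = "{e \<in> E. e \<subseteq> U}" and ?N = "real (card V)"
    interpret H: sparse_hypergraph V E k D C by (rule H)
    interpret U: sparse_hypergraph U ?E k D C by (rule H.induced[OF U])
    interpret nibble U ?E k D C d \<epsilon> by unfold_locales (use Suc.prems eps in auto)
    have UV: "real (card U) \<le> ?N" using card_mono[OF H.finite_V U] by simp
    have dev': "(\<Sum>v\<in>U. dev v) \<le> \<delta> * ?N * D" using dev by (simp add: dev_def)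
    let ?\<Phi> = "\<lambda>S. \<Sum>v\<in>U. (surviving_degree v S - decay * (d * D))\<^sup>2"
    obtain S where S: "S \<subseteq> ?E" and Z: "real (card S) + a * real (card (U - \<Union>S)) + \<kappa> / D\<^sup>2 * ?\<Phi> S
        \<le> a' * real (card U) + \<delta> * ?N * K"
      using one_round[OF UV dev' C, of a \<kappa>] \<delta> a \<kappa> unfolding a'_eq K_def by auto
    have \<Phi>0: "0 \<le> ?\<Phi> S" by (rule sum_nonneg) simp
    have \<delta>NK: "\<delta> * ?N * K \<le> \<mu> * ?N"
      using mult_right_mono[OF \<delta>K, of ?N] by (simp add: mult_ac)
    have "\<kappa> / D\<^sup>2 * ?\<Phi> S \<le> a' * ?N + 1 * ?N"
    proof -
      have "a' * real (card U) \<le> a' * ?N" using UV a by (intro mult_left_mono)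
      moreover have "\<mu> * ?N \<le> 1 * ?N" using \<mu> by (intro mult_right_mono) auto
      moreover have "0 \<le> a * real (card (U - \<Union>S))" using a by simp
      ultimately show ?thesis using Z \<delta>NK by linarith
    qed
    then have "?\<Phi> S \<le> (a' + 1) * ?N * D\<^sup>2 / \<kappa>"
      using \<kappa> H.D_pos by (simp add: field_simps)
    also have "\<dots> = \<delta>'\<^sup>2 / 4 * ?N * D\<^sup>2"
      using a \<delta>' by (simp add: \<kappa>_def field_simps)
    finally have \<Phi>: "?\<Phi> S \<le> \<delta>'\<^sup>2 / 4 * ?N * D\<^sup>2" .
    \<comment> \<open>Half of the tolerance for each of the two terms.\<close>
    let ?U = "U - \<Union>S"
    have "(\<Sum>v\<in>?U. \<bar>real (card (incident {e \<in> ?E. e \<subseteq> ?U} v)) - decay * (d * D)\<bar>)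
        \<le> ?\<Phi> S / (\<delta>' / 2 * D) + \<delta>' / 2 * D * real (card U)"
      by (rule deviation_of_survivors[OF S]) (use \<delta>' in simp)
    also have "\<dots> \<le> \<delta>'\<^sup>2 / 4 * ?N * D\<^sup>2 / (\<delta>' / 2 * D) + \<delta>' / 2 * D * ?N"
      using \<Phi> UV \<delta>' H.D_pos by (intro add_mono divide_right_mono mult_left_mono) auto
    also have "\<dots> = \<delta>' * ?N * D"
      using \<delta>' H.D_pos by (simp add: field_simps power2_eq_square)
    also have "{e \<in> ?E. e \<subseteq> ?U} = {e \<in> E. e \<subseteq> ?U}" by auto
    also have "decay * (d * D) = d' * D" by (simp add: decay_def d'_def)
    finally have dev_U: "(\<Sum>v\<in>?U. \<bar>real (card (incident {e \<in> E. e \<subseteq> ?U} v)) - d' * D\<bar>)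
        \<le> \<delta>' * ?N * D" .
    have C': "C \<le> \<delta>' * D" using C \<delta>(2) H.D_pos mult_right_mono[of \<delta> \<delta>' D] by linarith
    have "?U \<subseteq> V" using U by auto
    from IH[rule_format, OF conjI[OF H conjI[OF cov conjI[OF C' conjI[OF this dev_U]]]]] obtain F where F: "F \<subseteq> E" "?U \<subseteq> \<Union>F"
      "real (card F) \<le> a * real (card ?U) + \<gamma> / 2 * ?N" unfolding a_def by blast
    have "real (card (S \<union> F)) \<le> real (card S) + real (card F)"
      using card_Un_le[of S F] by linarith
    also have "\<dots> \<le> a' * real (card U) + \<gamma> * ?N"
    proof -
      have "0 \<le> \<kappa> / D\<^sup>2 * ?\<Phi> S" using \<kappa> \<Phi>0 by simp
      moreover have "\<mu> * ?N \<le> \<gamma> / 2 * ?N" using \<mu> by (intro mult_right_mono) auto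
      moreover have "\<gamma> * ?N = \<gamma> / 2 * ?N + \<gamma> / 2 * ?N" by simp
      ultimately show ?thesis using Z \<delta>NK F(3) by linarith
    qed
    finally show ?thesis
      using S F unfolding a'_def by (intro exI[of _ "S \<union> F"]) auto
  qed
  show ?case
    by (intro exI[of _ \<delta>] conjI[OF \<delta>(1)] allI impI, elim conjE) (rule step; assumption)
qed

text \<open>
  Pippenger's theorem in its covering form. In a regular hypergraph the deviations from \<open>D\<close> vanish, so the
  nibble can start with \<open>d = 1\<close>.
\<close>

theorem near_perfect_cover:
  fixes k :: nat and \<gamma> :: real
  assumes k: "1 \<le> k" and \<gamma>: "0 < \<gamma>"
  shows "\<exists>\<delta>>0. \<forall>(V :: 'v set) E D C.
    sparse_hypergraph V E k D C \<and> (\<forall>v\<in>V. real (card (incident E v)) = D) \<and> C \<le> \<delta> * D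
    \<longrightarrow> (\<exists>F\<subseteq>E. V \<subseteq> \<Union>F \<and> real (card F) \<le> (1 / real k + \<gamma>) * real (card V))"
proof -
  define \<epsilon> where "\<epsilon> = \<gamma> / 3"
  have eps: "0 < \<epsilon>" using \<gamma> by (simp add: \<epsilon>_def)
  have "(\<lambda>j. exp (- \<epsilon>) ^ j) \<longlonglongrightarrow> 0"
    by (rule LIMSEQ_power_zero) (use eps in simp)
  then have "eventually (\<lambda>j. exp (- \<epsilon>) ^ j < \<gamma> / 3) sequentially"
    by (rule order_tendstoD) (use \<gamma> in simp)
  then obtain j where "exp (- \<epsilon>) ^ j < \<gamma> / 3" by (auto simp: eventually_sequentially)
  then have j: "exp (- (\<epsilon> * real j)) < \<gamma> / 3" by (simp add: mult.commute flip: exp_of_nat_mult)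
  have "\<epsilon> / real k \<le> \<gamma> / 3"
    using k eps by (simp add: \<epsilon>_def divide_le_eq)
  moreover have "b + g / 3 \<le> i + g" if "b \<le> (i + e) + x" "e \<le> g / 3" "x < g / 3"
    for b g i e x :: real using that by linarith
  ultimately have budget: "budget \<epsilon> k j + \<gamma> / 3 \<le> 1 / real k + \<gamma>"
    using budget_le[OF eps k, of j] j by (simp only: add_divide_distrib)
  have "(0::real) < 1" "(1::real) \<le> 1" "0 < \<gamma> / 3" using \<gamma> by auto
  from nibble_cover[OF eps k this, of j] obtain \<delta> where \<delta>: "0 < \<delta>" and cover:
    "\<forall>(V :: 'v set) E D C U. sparse_hypergraph V E k D C \<and> V \<subseteq> \<Union>E \<and> C \<le> \<delta> * D \<and> U \<subseteq> V \<and>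
      (\<Sum>v\<in>U. \<bar>real (card (incident {e \<in> E. e \<subseteq> U} v)) - 1 * D\<bar>) \<le> \<delta> * real (card V) * D
      \<longrightarrow> (\<exists>F\<subseteq>E. U \<subseteq> \<Union>F \<and>
        real (card F) \<le> budget \<epsilon> k j * real (card U) + \<gamma> / 3 * real (card V))"
    by (elim exE conjE) (rule that)
  have result: "\<exists>F\<subseteq>E. V \<subseteq> \<Union>F \<and> real (card F) \<le> (1 / real k + \<gamma>) * real (card V)"
    if H: "sparse_hypergraph V E k D C" and reg: "\<forall>v\<in>V. real (card (incident E v)) = D"
      and C: "C \<le> \<delta> * D" for V :: "'v set" and E D C
  proof -
    interpret sparse_hypergraph V E k D C by (rule H)
    have cov: "V \<subseteq> \<Union>E"
    proof
      fix v assume "v \<in> V"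
      then have "card (incident E v) \<noteq> 0" using reg D_pos by auto
      then have "incident E v \<noteq> {}" by auto
      then show "v \<in> \<Union>E" by (auto simp: incident_def)
    qed
    have "{e \<in> E. e \<subseteq> V} = E" using edge by auto
    then have "(\<Sum>v\<in>V. \<bar>real (card (incident {e \<in> E. e \<subseteq> V} v)) - 1 * D\<bar>) = 0"
      using reg by simp
    then have dev: "(\<Sum>v\<in>V. \<bar>real (card (incident {e \<in> E. e \<subseteq> V} v)) - 1 * D\<bar>) \<le> \<delta> * real (card V) * D"
      using \<delta> D_pos by simp
    from cover[rule_format, OF conjI[OF H conjI[OF cov conjI[OF C conjI[OF subset_refl dev]]]]]
    obtain F where F: "F \<subseteq> E" "V \<subseteq> \<Union>F"
      "real (card F) \<le> budget \<epsilon> k j * real (card V) + \<gamma> / 3 * real (card V)" by blast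
    have "real (card F) \<le> (budget \<epsilon> k j + \<gamma> / 3) * real (card V)"
      using F(3) by (simp add: distrib_right)
    also have "\<dots> \<le> (1 / real k + \<gamma>) * real (card V)"
      using budget by (intro mult_right_mono) auto
    finally show ?thesis using F by blast
  qed
  show ?thesis
    by (intro exI[of _ \<delta>] conjI[OF \<delta>] allI impI, elim conjE) (rule result; assumption)
qed

section \<open>Roedl's covering theorem\<close>

lemma card_supersets:
  assumes X: "finite X" and u: "u \<subseteq> X" "card u \<le> t"
  shows "card {T. u \<subseteq> T \<and> T \<subseteq> X \<and> card T = t} = (card X - card u) choose (t - card u)"
proof -
  have fu: "finite u" using X u finite_subset by auto
  have "bij_betw (\<lambda>B. u \<union> B) {B. B \<subseteq> X - u \<and> card B = t - card u} {T. u \<subseteq> T \<and> T \<subseteq> X \<and> card T = t}"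
  proof (rule bij_betw_byWitness[where f' = "\<lambda>T. T - u"])
    have "card (u \<union> B) = t" if "B \<subseteq> X - u" "card B = t - card u" for B
    proof -
      have "finite B" using that X finite_subset by auto
      then have "card (u \<union> B) = card u + card B" using that fu by (intro card_Un_disjoint) auto
      then show ?thesis using that u by simp
    qed
    then show "(\<lambda>B. u \<union> B) ` {B. B \<subseteq> X - u \<and> card B = t - card u} \<subseteq> {T. u \<subseteq> T \<and> T \<subseteq> X \<and> card T = t}"
      using u by auto
    show "(\<lambda>T. T - u) ` {T. u \<subseteq> T \<and> T \<subseteq> X \<and> card T = t} \<subseteq> {B. B \<subseteq> X - u \<and> card B = t - card u}"
      using fu by (auto simp: card_Diff_subset)
  qed auto
  then have "card {T. u \<subseteq> T \<and> T \<subseteq> X \<and> card T = t} = card {B. B \<subseteq> X - u \<and> card B = t - card u}"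
    by (simp add: bij_betw_same_card)
  also have "\<dots> = (card X - card u) choose (t - card u)"
    using n_subsets[of "X - u" "t - card u"] X fu u by (simp add: card_Diff_subset)
  finally show ?thesis .
qed

definition subsets_of_card :: "nat \<Rightarrow> 'a set \<Rightarrow> 'a set set" where
  "subsets_of_card s X = {u. u \<subseteq> X \<and> card u = s}"

lemma card_subsets_of_card: "finite X \<Longrightarrow> card (subsets_of_card s X) = card X choose s"
  unfolding subsets_of_card_def by (rule n_subsets)

lemma Union_subsets_of_card:
  assumes T: "finite T" and s: "1 \<le> s" "s \<le> card T"
  shows "\<Union>(subsets_of_card s T) = T"
proof
  show "T \<subseteq> \<Union>(subsets_of_card s T)"
  proof
    fix x assume x: "x \<in> T"
    obtain u where "{x} \<subseteq> u" "u \<subseteq> T" "card u = s"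
      using exists_subset_between[of "{x}" s T] x s T by auto
    then show "x \<in> \<Union>(subsets_of_card s T)" by (auto simp: subsets_of_card_def)
  qed
qed (auto simp: subsets_of_card_def)

text \<open>
  Roedl's problem as a hypergraph: the vertices are the \<open>s\<close>-sets, and each \<open>t\<close>-set gives the edge of all \<open>s\<close>-sets
  inside it. The union of two distinct \<open>s\<close>-sets has more than \<open>s\<close> elements, so the codegree is at
  most the number of \<open>t\<close>-sets that contain a fixed set of size \<open>s + 1\<close>, which is the degree times
  \<open>(t - s) / (card X - s)\<close>. For \<open>s = 0\<close> different \<open>t\<close>-sets would give the same edge.
\<close>

lemma shadow_hypergraph:
  fixes X :: "'a set"
  assumes X: "finite X" and s: "1 \<le> s" "s \<le> t" and n: "t < card X"
  defines "D \<equiv> real ((card X - s) choose (t - s))"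
  defines "E \<equiv> subsets_of_card s ` subsets_of_card t X"
  shows "sparse_hypergraph (subsets_of_card s X) E (t choose s) D (real (t - s) / real (card X - s) * D)"
    and "u \<in> subsets_of_card s X \<Longrightarrow> real (card (incident E u)) = D"
proof -
  have fin: "finite T" if "T \<in> subsets_of_card t X" for T
    using that X finite_subset by (auto simp: subsets_of_card_def)
  have inj: "inj_on (subsets_of_card s) (subsets_of_card t X)"
  proof (rule inj_onI)
    fix T T' assume T: "T \<in> subsets_of_card t X" "T' \<in> subsets_of_card t X"
      and eq: "subsets_of_card s T = subsets_of_card s T'"
    have "\<Union>(subsets_of_card s T) = T" if "T \<in> subsets_of_card t X" for T
      by (rule Union_subsets_of_card[OF fin[OF that] s(1)])
        (use that s in \<open>simp add: subsets_of_card_def\<close>)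
    from this[OF T(1)] this[OF T(2)] show "T = T'" using eq by metis
  qed
  have incident_eq: "incident E u = subsets_of_card s ` {T. u \<subseteq> T \<and> T \<subseteq> X \<and> card T = t}"
    if "card u = s" for u
  proof -
    have "incident E u = subsets_of_card s ` {T \<in> subsets_of_card t X. u \<in> subsets_of_card s T}"
      unfolding incident_def E_def by blast
    also have "{T \<in> subsets_of_card t X. u \<in> subsets_of_card s T} = {T. u \<subseteq> T \<and> T \<subseteq> X \<and> card T = t}"
      using that by (auto simp: subsets_of_card_def)
    finally show ?thesis .
  qed
  have inj': "inj_on (subsets_of_card s) {T. u \<subseteq> T \<and> T \<subseteq> X \<and> card T = t}" for u
    by (rule inj_on_subset[OF inj]) (auto simp: subsets_of_card_def)
  have regular: "real (card (incident E u)) = D" if u: "u \<in> subsets_of_card s X" for u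
  proof -
    have "card u = s" "u \<subseteq> X" using u by (auto simp: subsets_of_card_def)
    then show ?thesis
      using card_supersets[OF X, of u t] s by (simp add: incident_eq card_image[OF inj'] D_def)
  qed
  then show "u \<in> subsets_of_card s X \<Longrightarrow> real (card (incident E u)) = D" .
  show "sparse_hypergraph (subsets_of_card s X) E (t choose s) D (real (t - s) / real (card X - s) * D)"
  proof
    show "finite (subsets_of_card s X)" using X by (simp add: subsets_of_card_def)
    show "1 \<le> t choose s" using s by (simp add: Suc_le_eq)
    show "0 < D" using s n by (simp add: D_def)
    then show "0 \<le> real (t - s) / real (card X - s) * D" by simp
    show "e \<subseteq> subsets_of_card s X \<and> card e = t choose s" if e: "e \<in> E" for e
    proof -
      obtain T where T: "T \<in> subsets_of_card t X" "e = subsets_of_card s T" using e by (auto simp: E_def)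
      then show ?thesis
        using card_subsets_of_card[OF fin[OF T(1)], of s] by (auto simp: subsets_of_card_def)
    qed
    show "real (card (incident E u)) \<le> D" if "u \<in> subsets_of_card s X" for u
      using regular[OF that] by simp
    fix u v :: "'a set" assume u: "u \<in> subsets_of_card s X" and v: "v \<in> subsets_of_card s X" and uv: "u \<noteq> v"
    have cards: "card u = s" "card v = s" "u \<subseteq> X" "v \<subseteq> X" "finite u" "finite v"
      using u v X finite_subset by (auto simp: subsets_of_card_def)
    obtain x where x: "x \<in> v" "x \<notin> u"
      using uv cards card_subset_eq[of u v] by (metis subsetI)
    let ?w = "insert x u"
    have w: "?w \<subseteq> X" "card ?w = Suc s" using x cards by auto
    have sub: "incident E u \<inter> incident E v \<subseteq> subsets_of_card s ` {T. ?w \<subseteq> T \<and> T \<subseteq> X \<and> card T = t}"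
    proof
      fix e assume "e \<in> incident E u \<inter> incident E v"
      then obtain T where T: "T \<in> subsets_of_card t X" "e = subsets_of_card s T" and "u \<in> e" "v \<in> e"
        unfolding incident_def E_def by blast
      then have "u \<subseteq> T" "v \<subseteq> T" by (simp_all add: subsets_of_card_def)
      then have "T \<in> {T. ?w \<subseteq> T \<and> T \<subseteq> X \<and> card T = t}"
        using T(1) x by (auto simp: subsets_of_card_def)
      then show "e \<in> subsets_of_card s ` {T. ?w \<subseteq> T \<and> T \<subseteq> X \<and> card T = t}"
        unfolding T(2) by (rule imageI)
    qed
    have fins: "finite {T. ?w \<subseteq> T \<and> T \<subseteq> X \<and> card T = t}" using X by simp
    have "card (incident E u \<inter> incident E v) \<le> card {T. ?w \<subseteq> T \<and> T \<subseteq> X \<and> card T = t}"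
      using card_mono[OF _ sub] card_image_le[OF fins, of "subsets_of_card s"] fins
      by (meson finite_imageI order_trans)
    also have "real \<dots> \<le> real (t - s) / real (card X - s) * D"
    proof (cases "t = s")
      case True
      have "{T. ?w \<subseteq> T \<and> T \<subseteq> X \<and> card T = t} = {}"
      proof -
        have False if "?w \<subseteq> T" "T \<subseteq> X" "card T = t" for T
          using card_mono[OF finite_subset[OF that(2) X] that(1)] w True that by simp
        then show ?thesis by blast
      qed
      then show ?thesis by (simp only: card.empty) (simp add: D_def)
    next
      case False
      then have st: "Suc s \<le> t" using s by simp
      obtain m where m: "card X - s = Suc m" using n s by (metis Suc_diff_Suc le_less_trans)
      obtain r where r: "t - s = Suc r" using st by (metis Suc_diff_Suc Suc_le_eq)
      have e: "card X - Suc s = m" "t - Suc s = r" using m r by linarith+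
      have count: "card {T. ?w \<subseteq> T \<and> T \<subseteq> X \<and> card T = t} = m choose r"
        by (rule card_supersets[OF X w(1), of t, unfolded w(2) e, OF st])
      have "Suc r * (Suc m choose Suc r) = Suc m * (m choose r)" by (rule Suc_times_binomial)
      then have "real (Suc r) * real (Suc m choose Suc r) = real (Suc m) * real (m choose r)"
        by (simp only: flip: of_nat_mult)
      then have "real (m choose r) = real (Suc r) / real (Suc m) * real (Suc m choose Suc r)"
        by (simp only: times_divide_eq_left eq_divide_eq mult.commute[of "real (m choose r)"]) simp
      then show ?thesis unfolding count D_def m r by simp
    qed
    finally show "real (card (incident E u \<inter> incident E v)) \<le> real (t - s) / real (card X - s) * D"
      by simp
  qed
qed

theorem roedl_covering:
  fixes s t :: nat and \<gamma> :: real
  assumes s: "s \<le> t" and \<gamma>: "0 < \<gamma>"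
  shows "\<exists>n\<^sub>0. \<forall>X :: 'a set. finite X \<and> n\<^sub>0 \<le> card X \<longrightarrow>
    (\<exists>\<T> \<subseteq> subsets_of_card t X. (\<forall>u\<in>subsets_of_card s X. \<exists>T\<in>\<T>. u \<subseteq> T) \<and>
      real (card \<T>) \<le> (1 / real (t choose s) + \<gamma>) * real (card X choose s))"
proof (cases "s = 0")
  case True
  have "\<exists>\<T> \<subseteq> subsets_of_card t X. (\<forall>u\<in>subsets_of_card s X. \<exists>T\<in>\<T>. u \<subseteq> T) \<and>
      real (card \<T>) \<le> (1 / real (t choose s) + \<gamma>) * real (card X choose s)"
    if X: "finite X" "t \<le> card X" for X :: "'a set"
  proof -
    obtain T where "T \<subseteq> X" "card T = t" using obtain_subset_with_card_n[OF X(2)] by blast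
    moreover have "u = {}" if "u \<subseteq> X" "card u = 0" for u
      using that X finite_subset card_0_eq by metis
    ultimately show ?thesis
      using True \<gamma> by (intro exI[of _ "{T}"]) (auto simp: subsets_of_card_def)
  qed
  then show ?thesis by blast
next
  case False
  then have s1: "1 \<le> s" by simp
  have "1 \<le> t choose s" using s by (simp add: Suc_le_eq)
  from near_perfect_cover[OF this \<gamma>] obtain \<delta> where \<delta>: "0 < \<delta>" and cover:
    "\<forall>(V :: 'a set set) E D C. sparse_hypergraph V E (t choose s) D C \<and>
      (\<forall>v\<in>V. real (card (incident E v)) = D) \<and> C \<le> \<delta> * D
    \<longrightarrow> (\<exists>F\<subseteq>E. V \<subseteq> \<Union>F \<and> real (card F) \<le> (1 / real (t choose s) + \<gamma>) * real (card V))"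
    by (elim exE conjE) (rule that)
  obtain m :: nat where m: "real (t - s) / \<delta> < real m" using reals_Archimedean2 by blast
  have step: "\<exists>\<T> \<subseteq> subsets_of_card t X. (\<forall>u\<in>subsets_of_card s X. \<exists>T\<in>\<T>. u \<subseteq> T) \<and>
      real (card \<T>) \<le> (1 / real (t choose s) + \<gamma>) * real (card X choose s)"
    if X: "finite X" and n: "Suc t + m \<le> card X" for X :: "'a set"
  proof -
    let ?V = "subsets_of_card s X" and ?E = "subsets_of_card s ` subsets_of_card t X"
    let ?D = "real ((card X - s) choose (t - s))"
    have tX: "t < card X" using n by simp
    note H = shadow_hypergraph[OF X s1 s tX]
    have "real (t - s) / real (card X - s) \<le> \<delta>"
    proof -
      have "real m \<le> real (card X - s)" using n s by simp
      then have "real (t - s) / \<delta> < real (card X - s)" using m by linarith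
      then show ?thesis using \<delta> tX s by (simp add: field_simps)
    qed
    then have "real (t - s) / real (card X - s) * ?D \<le> \<delta> * ?D" by (intro mult_right_mono) auto
    from cover[rule_format, OF conjI[OF H(1) conjI[OF ballI[OF H(2)] this]]]
    obtain F where F: "F \<subseteq> ?E" "?V \<subseteq> \<Union>F"
      "real (card F) \<le> (1 / real (t choose s) + \<gamma>) * real (card ?V)" by blast
    obtain \<T> where \<T>: "\<T> \<subseteq> subsets_of_card t X" "F = subsets_of_card s ` \<T>" "inj_on (subsets_of_card s) \<T>"
      using F(1) subset_image_inj by metis
    have "card \<T> = card F" using card_image[OF \<T>(3)] \<T>(2) by simp
    moreover have "\<forall>u\<in>?V. \<exists>T\<in>\<T>. u \<subseteq> T"
    proof
      fix u assume "u \<in> ?V"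
      then have "u \<in> \<Union>(subsets_of_card s ` \<T>)" using F(2) \<T>(2) by blast
      then show "\<exists>T\<in>\<T>. u \<subseteq> T" by (auto simp: subsets_of_card_def)
    qed
    ultimately show ?thesis using F(3) \<T>(1) card_subsets_of_card[OF X, of s] by auto
  qed
  show ?thesis
    by (intro exI[of _ "Suc t + m"] allI impI, elim conjE) (rule step; assumption)
qed

section \<open>Complete multipartite subgraphs of dense hypergraphs\<close>

text \<open>
  Erdos's theorem that a dense \<open>s\<close>-uniform hypergraph contains a complete \<open>s\<close>-partite one with two
  vertices in each part, for sets of ordered tuples. Two distinct first entries \<open>a\<close>, \<open>b\<close> whose common link is
  dense are found by counting pairs of tuples with equal tails; the pairs with \<open>a = b\<close> are
  negligible for large \<open>card X\<close>, which leaves density \<open>\<gamma>\<^sup>2 / 2\<close> for the link.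
\<close>

lemma complete_partite_box:
  fixes \<gamma> :: real
  assumes "0 < \<gamma>"
  shows "\<exists>n\<^sub>0. \<forall>(X :: 'a set) R. finite X \<and> n\<^sub>0 \<le> card X \<and>
      R \<subseteq> {xs. set xs \<subseteq> X \<and> length xs = s} \<and> \<gamma> * real (card X) ^ s \<le> real (card R)
    \<longrightarrow> (\<exists>ps. length ps = s \<and> (\<forall>(a, b)\<in>set ps. a \<noteq> b) \<and>
      (\<forall>xs. list_all2 (\<lambda>x (a, b). x = a \<or> x = b) xs ps \<longrightarrow> xs \<in> R))"
  using assms
proof (induction s arbitrary: \<gamma>)
  case 0
  have "[] \<in> R" if "R \<subseteq> {xs. set xs \<subseteq> X \<and> length xs = 0}" "\<gamma> \<le> real (card R)" for X :: "'a set" and R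
  proof -
    have "R \<noteq> {}" using that 0 by auto
    then show ?thesis using that(1) by auto
  qed
  then show ?case by (intro exI[of _ 0]) auto
next
  case (Suc s)
  define \<gamma>' where "\<gamma>' = \<gamma>\<^sup>2 / 2"
  have \<gamma>': "0 < \<gamma>'" using Suc.prems by (simp add: \<gamma>'_def)
  from Suc.IH[OF \<gamma>'] obtain n1 where IH: "\<forall>(X :: 'a set) R. finite X \<and> n1 \<le> card X \<and>
      R \<subseteq> {xs. set xs \<subseteq> X \<and> length xs = s} \<and> \<gamma>' * real (card X) ^ s \<le> real (card R)
    \<longrightarrow> (\<exists>ps. length ps = s \<and> (\<forall>(a, b)\<in>set ps. a \<noteq> b) \<and>
      (\<forall>xs. list_all2 (\<lambda>x (a, b). x = a \<or> x = b) xs ps \<longrightarrow> xs \<in> R))"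
    by (elim exE) (rule that)
  obtain n2 :: nat where n2: "1 / \<gamma>' < real n2" using reals_Archimedean2 by blast
  have step: "\<exists>ps. length ps = Suc s \<and> (\<forall>(a, b)\<in>set ps. a \<noteq> b) \<and>
      (\<forall>xs. list_all2 (\<lambda>x (a, b). x = a \<or> x = b) xs ps \<longrightarrow> xs \<in> R)"
    if X: "finite X" and n: "max n1 n2 \<le> card X"
      and R: "R \<subseteq> {xs. set xs \<subseteq> X \<and> length xs = Suc s}"
      and dense: "\<gamma> * real (card X) ^ Suc s \<le> real (card R)" for X :: "'a set" and R
  proof -
    define N where "N = real (card X)"
    define L where "L = {ys. set ys \<subseteq> X \<and> length ys = s}"
    define deg where "deg y = real (card {a \<in> X. a # y \<in> R})" for y
    define link where "link a b = {y \<in> L. a # y \<in> R \<and> b # y \<in> R}" for a b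
    have finL: "finite L" and cardL: "real (card L) = N ^ s"
      using finite_lists_length_eq[OF X] card_lists_length_eq[OF X, of s]
      by (auto simp: L_def N_def)
    have N: "1 / \<gamma>' < N" using n n2 by (simp add: N_def)
    have deg_sum: "deg y = (\<Sum>a\<in>X. of_bool (a # y \<in> R))" for y
      using X by (simp add: deg_def of_bool_def sum.If_cases Int_def)
    have "xs \<in> R \<longleftrightarrow> (\<exists>y\<in>L. \<exists>a\<in>X. xs = a # y \<and> a # y \<in> R)" for xs
    proof (cases xs)
      case Nil
      then show ?thesis using R by auto
    next
      case (Cons a y)
      have "a \<in> X \<and> y \<in> L" if "a # y \<in> R" using subsetD[OF R that] by (simp add: L_def)
      then show ?thesis using Cons by auto
    qed
    then have R_eq: "R = (\<Union>y\<in>L. (\<lambda>a. a # y) ` {a \<in> X. a # y \<in> R})" by blast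
    have "card R = card (\<Union>y\<in>L. (\<lambda>a. a # y) ` {a \<in> X. a # y \<in> R})"
      by (rule arg_cong[where f = card, OF R_eq])
    also have "\<dots> = (\<Sum>y\<in>L. card ((\<lambda>a. a # y) ` {a \<in> X. a # y \<in> R}))"
      using finL X by (intro card_UN_disjoint) auto
    also have "\<dots> = (\<Sum>y\<in>L. card {a \<in> X. a # y \<in> R})"
      by (intro sum.cong refl card_image) (auto intro: inj_onI)
    finally have cardR: "real (card R) = (\<Sum>y\<in>L. deg y)" by (simp add: deg_def)
    have pairs: "(\<Sum>a\<in>X. \<Sum>b\<in>X. real (card (link a b))) = (\<Sum>y\<in>L. (deg y)\<^sup>2)"
    proof -
      have "(\<Sum>y\<in>L. (deg y)\<^sup>2) = (\<Sum>y\<in>L. \<Sum>a\<in>X. \<Sum>b\<in>X. of_bool (a # y \<in> R \<and> b # y \<in> R))"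
        unfolding deg_sum power2_eq_square sum_product by (intro sum.cong refl) simp
      also have "\<dots> = (\<Sum>a\<in>X. \<Sum>y\<in>L. \<Sum>b\<in>X. of_bool (a # y \<in> R \<and> b # y \<in> R))"
        by (rule sum.swap)
      also have "\<dots> = (\<Sum>a\<in>X. \<Sum>b\<in>X. \<Sum>y\<in>L. of_bool (a # y \<in> R \<and> b # y \<in> R))"
        by (rule sum.cong[OF refl]) (rule sum.swap)
      also have "\<dots> = (\<Sum>a\<in>X. \<Sum>b\<in>X. real (card (link a b)))"
        using finL by (simp add: link_def of_bool_def sum.If_cases Int_def)
      finally show ?thesis by simp
    qed
    have "\<exists>a\<in>X. \<exists>b\<in>X. a \<noteq> b \<and> \<gamma>' * N ^ s \<le> real (card (link a b))"
    proof (rule ccontr)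
      assume no: "\<not> ?thesis"
      have link_le: "real (card (link a b)) \<le> N ^ s" for a b
        unfolding cardL[symmetric] using finL by (auto simp: link_def intro!: card_mono)
      have "(\<Sum>y\<in>L. (deg y)\<^sup>2) \<le> (\<Sum>a\<in>X. \<Sum>b\<in>X. \<gamma>' * N ^ s + of_bool (b = a) * N ^ s)"
        unfolding pairs[symmetric]
      proof (intro sum_mono)
        fix a b assume ab: "a \<in> X" "b \<in> X"
        show "real (card (link a b)) \<le> \<gamma>' * N ^ s + of_bool (b = a) * N ^ s"
        proof (cases "b = a")
          case True
          have "0 \<le> \<gamma>' * N ^ s" using \<gamma>' by (simp add: N_def)
          then show ?thesis using link_le[of a b] True by simp
        next
          case False
          then show ?thesis using no ab by fastforce
        qed
      qed
      also have "\<dots> = N * (N * (\<gamma>' * N ^ s) + N ^ s)"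
        using X by (simp add: sum.distrib N_def flip: sum_distrib_right)
      finally have upper: "(\<Sum>y\<in>L. (deg y)\<^sup>2) \<le> N * (N * (\<gamma>' * N ^ s) + N ^ s)" .
      have "2 * (\<gamma> * N) * (\<gamma> * N ^ Suc s) \<le> 2 * (\<gamma> * N) * (\<Sum>y\<in>L. deg y)"
        using dense Suc.prems unfolding cardR N_def[symmetric]
        by (intro mult_left_mono) (auto simp: N_def)
      also have "\<dots> = (\<Sum>y\<in>L. 2 * (\<gamma> * N) * deg y)" by (rule sum_distrib_left)
      also have "\<dots> \<le> (\<Sum>y\<in>L. (deg y)\<^sup>2 + (\<gamma> * N)\<^sup>2)"
      proof (rule sum_mono)
        \<comment> \<open>The tangent to the square at the mean degree \<open>\<gamma> * N\<close> replaces the Cauchy-Schwarz inequality.\<close>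
        fix y show "2 * (\<gamma> * N) * deg y \<le> (deg y)\<^sup>2 + (\<gamma> * N)\<^sup>2"
          using sum_squares_bound[of "\<gamma> * N" "deg y"] by linarith
      qed
      also have "\<dots> = (\<Sum>y\<in>L. (deg y)\<^sup>2) + N ^ s * (\<gamma> * N)\<^sup>2"
        using cardL by (simp add: sum.distrib)
      finally have "2 * (\<gamma> * N) * (\<gamma> * N ^ Suc s)
          \<le> N * (N * (\<gamma>' * N ^ s) + N ^ s) + N ^ s * (\<gamma> * N)\<^sup>2" using upper by linarith
      moreover have "2 * (\<gamma> * N) * (\<gamma> * N ^ Suc s)
          = N * (N * (\<gamma>' * N ^ s)) + N ^ s * (\<gamma> * N)\<^sup>2 + (\<gamma>' * N) * (N * N ^ s)"
        by (simp add: \<gamma>'_def power2_eq_square algebra_simps)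
      ultimately have "(\<gamma>' * N) * (N * N ^ s) \<le> 1 * (N * N ^ s)"
        by (simp add: algebra_simps)
      moreover have "0 < N" using N \<gamma>' by (meson less_trans zero_less_divide_1_iff)
      ultimately have "\<gamma>' * N \<le> 1" by (simp only: mult_le_cancel_right) auto
      then show False using N \<gamma>' by (simp add: field_simps)
    qed
    then obtain a b where ab: "a \<noteq> b" "\<gamma>' * real (card X) ^ s \<le> real (card (link a b))"
      by (auto simp: N_def)
    have "n1 \<le> card X" and link: "link a b \<subseteq> {xs. set xs \<subseteq> X \<and> length xs = s}"
      using n by (auto simp: link_def L_def)
    from IH[rule_format, OF conjI[OF X conjI[OF this(1) conjI[OF link ab(2)]]]]
    obtain ps where ps: "length ps = s" "\<forall>(a, b)\<in>set ps. a \<noteq> b"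
      "\<And>xs. list_all2 (\<lambda>x (a, b). x = a \<or> x = b) xs ps \<Longrightarrow> xs \<in> link a b" by blast
    have "xs \<in> R" if "list_all2 (\<lambda>x (a, b). x = a \<or> x = b) xs ((a, b) # ps)" for xs
      using that ps(3) by (auto simp: list_all2_Cons2 link_def)
    then show ?thesis using ps ab by (intro exI[of _ "(a, b) # ps"]) auto
  qed
  show ?case
    by (intro exI[of _ "max n1 n2"] allI impI, elim conjE) (rule step; assumption)
qed

section \<open>Crossing hypergraphs and the asymptotics\<close>

text \<open>
  Pick a representative in each class. The elements left over form an \<open>s\<close>-set, and the complement of a \<open>T\<close> that
  contains it consists of representatives of distinct classes.
\<close>

lemma min_crossing_le_cover:
  assumes s: "s \<le> t" and n: "t \<le> n"
    and T: "\<T> \<subseteq> subsets_of_card t {..<n}"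
    and cover: "\<And>u. u \<in> subsets_of_card s {..<n} \<Longrightarrow> \<exists>T\<in>\<T>. u \<subseteq> T"
  shows "min_crossing n (n - s) (n - t) \<le> card \<T>"
proof -
  let ?X = "{..<n}" and ?\<H> = "(\<lambda>T. {..<n} - T) ` \<T>"
  have finT: "finite \<T>"
    by (rule finite_subset[OF T]) (auto simp: subsets_of_card_def)
  have card_compl: "card (?X - T) = n - t" if "T \<in> \<T>" for T
    using T that by (auto simp: subsets_of_card_def card_Diff_subset finite_subset)
  have "crosses ?\<H> P" if "k_partition ?X (n - s) P" for P
  proof -
    have P: "partition_on ?X P" "finite P" "card P = n - s" using that by (auto simp: k_partition_def)
    have "\<forall>C\<in>P. \<exists>x. x \<in> C" using P(1) unfolding partition_on_def by (metis all_not_in_conv)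
    then obtain c where c: "\<And>C. C \<in> P \<Longrightarrow> c C \<in> C" by metis
    have same: "C = C'" if "C \<in> P" "C' \<in> P" "x \<in> C" "x \<in> C'" for C C' x
      using P(1) that by (auto simp: partition_on_def disjoint_def)
    have inj: "inj_on c P" by (rule inj_onI) (metis c same)
    have cX: "c ` P \<subseteq> ?X" using c P(1) by (auto simp: partition_on_def)
    have "card (?X - c ` P) = s"
      using s n P cX card_image[OF inj] by (simp add: card_Diff_subset)
    then have "?X - c ` P \<in> subsets_of_card s ?X" by (auto simp: subsets_of_card_def)
    then obtain T where T: "T \<in> \<T>" "?X - c ` P \<subseteq> T" using cover by blast
    let ?H = "?X - T"
    have H: "?H \<subseteq> c ` P" using T by auto
    have "{C \<in> P. ?H \<inter> C \<noteq> {}} = {C \<in> P. c C \<in> ?H}"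
    proof -
      have "c C \<in> ?H" if C: "C \<in> P" and meets: "?H \<inter> C \<noteq> {}" for C
      proof -
        obtain x where x: "x \<in> ?H" "x \<in> C" using meets by blast
        then obtain C' where C': "C' \<in> P" "x = c C'" using H by blast
        then have "x \<in> C'" using c by simp
        then show ?thesis using same[OF C'(1) C _ x(2)] C'(2) x(1) by simp
      qed
      then show ?thesis using c by blast
    qed
    moreover have "card {C \<in> P. c C \<in> ?H} = card ?H"
    proof -
      have "c ` {C \<in> P. c C \<in> ?H} = ?H" using H by auto
      moreover have "inj_on c {C \<in> P. c C \<in> ?H}" by (rule inj_on_subset[OF inj]) auto
      ultimately show ?thesis using card_image by metis
    qed
    moreover have "card ?H \<le> card P" using card_compl[OF T(1)] P(3) s by simp
    ultimately have "edge_crosses ?H P" by (simp add: edge_crosses_def)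
    then show ?thesis using T(1) by (auto simp: crosses_def)
  qed
  moreover have "uniform_hypergraph ?X (n - t) ?\<H>"
    using card_compl by (auto simp: uniform_hypergraph_def)
  ultimately have "crossing_hypergraph ?X (n - s) (n - t) ?\<H>"
    by (simp add: crossing_hypergraph_def)
  then have "min_crossing n (n - s) (n - t) \<le> card ?\<H>"
    unfolding min_crossing_def by (intro wellorder_Inf_le1) auto
  also have "\<dots> \<le> card \<T>" using finT by (rule card_image_le)
  finally show ?thesis .
qed

text \<open>
  The elements of \<open>H\<close> are distributed over at least \<open>card H\<close> classes, so no class gets two of them.
\<close>

lemma crossed_class_card_le:
  assumes X: "finite X" and P: "partition_on X P" and H: "H \<subseteq> X"
    and cross: "card H \<le> card {C \<in> P. H \<inter> C \<noteq> {}}" and C: "C \<in> P"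
  shows "card (H \<inter> C) \<le> 1"
proof (rule ccontr)
  assume no: "\<not> ?thesis"
  let ?Q = "{C \<in> P. H \<inter> C \<noteq> {}}"
  have finP: "finite P" using finite_elements[OF X P] .
  have finH: "finite H" using H X finite_subset by auto
  have "H = (\<Union>C\<in>?Q. H \<inter> C)" using P H by (auto simp: partition_on_def)
  then have "card H = card (\<Union>C\<in>?Q. H \<inter> C)" by (rule arg_cong)
  also have "\<dots> = (\<Sum>C\<in>?Q. card (H \<inter> C))"
    by (rule card_UN_disjoint) (use finP finH P in \<open>auto simp: partition_on_def disjoint_def\<close>)
  finally have sum: "card H = (\<Sum>C\<in>?Q. card (H \<inter> C))" .
  have "(\<Sum>C\<in>?Q. 1) < (\<Sum>C\<in>?Q. card (H \<inter> C))"
  proof (rule sum_strict_mono_ex1)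
    show "finite ?Q" using finP by simp
    show "\<forall>C\<in>?Q. 1 \<le> card (H \<inter> C)" using finH by (auto simp: Suc_le_eq card_gt_0_iff)
    show "\<exists>C\<in>?Q. 1 < card (H \<inter> C)" using no C by (intro bexI[of _ C]) auto
  qed
  then show False using sum cross by simp
qed

text \<open>
  The list \<open>ps\<close> holds the two-element parts. All their transversals are lists of distinct elements, so
  the parts are disjoint and together with singletons form a partition into \<open>card X - s\<close> classes. The
  edge that crosses it has at most one element in each part, so a transversal misses it.
\<close>

lemma no_box_avoids_complements:
  assumes cross: "crossing_hypergraph X (card X - s) (card X - t) \<H>" and X: "finite X" and s: "s \<le> t"
    and ps: "length ps = s" "\<forall>(a, b)\<in>set ps. a \<noteq> b"
    and box: "\<And>xs. list_all2 (\<lambda>x (a, b). x = a \<or> x = b) xs ps \<Longrightarrow>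
      distinct xs \<and> set xs \<subseteq> X \<and> (\<forall>H\<in>\<H>. set xs \<inter> H \<noteq> {})"
  shows False
proof -
  define pr where "pr i = {fst (ps ! i), snd (ps ! i)}" for i
  have choice: "distinct (map c [0..<s]) \<and> c ` {..<s} \<subseteq> X \<and> (\<forall>H\<in>\<H>. c ` {..<s} \<inter> H \<noteq> {})"
    if "\<And>i. i < s \<Longrightarrow> c i \<in> pr i" for c
  proof -
    have "list_all2 (\<lambda>x (a, b). x = a \<or> x = b) (map c [0..<s]) ps"
      unfolding list_all2_conv_all_nth using ps(1) that by (auto simp: pr_def case_prod_unfold)
    from box[OF this] show ?thesis by (simp add: atLeast0LessThan)
  qed
  have pr_card: "card (pr i) = 2" if "i < s" for i
  proof -
    have "ps ! i \<in> set ps" using that ps(1) by simp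
    then show ?thesis using ps(2) by (auto simp: pr_def case_prod_unfold)
  qed
  have pr_disj: "pr i \<inter> pr j = {}" if ij: "i < s" "j < s" "i \<noteq> j" for i j
  proof (rule ccontr)
    assume "\<not> ?thesis"
    then obtain x where x: "x \<in> pr i" "x \<in> pr j" by auto
    \<comment> \<open>A common element of two parts would occur twice in some transversal.\<close>
    define c where "c l = (if l = i \<or> l = j then x else fst (ps ! l))" for l
    have "distinct (map c [0..<s])" using choice[of c] x by (auto simp: c_def pr_def)
    then have "inj_on c {..<s}" by (simp add: distinct_map atLeast0LessThan)
    then have "i = j" using ij by (auto simp: c_def dest!: inj_onD[of c _ i j])
    then show False using ij by simp
  qed
  have pr_X: "pr i \<subseteq> X" if i: "i < s" for i
  proof
    fix x assume x: "x \<in> pr i"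
    have "(\<lambda>l. if l = i then x else fst (ps ! l)) ` {..<s} \<subseteq> X"
      using choice[of "\<lambda>l. if l = i then x else fst (ps ! l)"] x by (auto simp: pr_def)
    then show "x \<in> X" using i by force
  qed
  let ?B = "\<Union>i<s. pr i"
  define P where "P = pr ` {..<s} \<union> (\<lambda>x. {x}) ` (X - ?B)"
  have finB: "finite ?B" by (auto simp: pr_def)
  have BX: "?B \<subseteq> X" using pr_X by auto
  have "card ?B = (\<Sum>i<s. card (pr i))"
    using pr_disj by (intro card_UN_disjoint) (auto simp: pr_def)
  then have cardB: "card ?B = 2 * s" using pr_card by simp
  have part: "partition_on X P"
  proof (rule partition_onI)
    show "\<Union>P = X" using BX by (auto simp: P_def)
    fix C C' assume C: "C \<in> P" "C' \<in> P" "C \<noteq> C'"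
    show "disjnt C C'"
      unfolding disjnt_def using C pr_disj unfolding P_def by (auto; blast)
  qed (auto simp: P_def pr_def)
  have "inj_on pr {..<s}"
  proof (rule inj_onI)
    fix i j assume "i \<in> {..<s}" "j \<in> {..<s}" "pr i = pr j"
    then show "i = j" using pr_disj[of i j] by (auto simp: pr_def)
  qed
  then have card1: "card (pr ` {..<s}) = s" by (simp add: card_image)
  have card2: "card ((\<lambda>x. {x}) ` (X - ?B)) = card X - 2 * s"
    using cardB finB BX by (simp add: card_image card_Diff_subset)
  have "2 * s \<le> card X" using card_mono[OF X BX] cardB by simp
  moreover have "pr ` {..<s} \<inter> (\<lambda>x. {x}) ` (X - ?B) = {}" by (auto simp: pr_def)
  ultimately have "card P = card X - s"
    unfolding P_def using X card1 card2 by (subst card_Un_disjoint) auto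
  then have "k_partition X (card X - s) P"
    using part finite_elements[OF X part] by (simp add: k_partition_def)
  then obtain H where H: "H \<in> \<H>" "edge_crosses H P"
    using cross by (auto simp: crossing_hypergraph_def crosses_def)
  have HX: "H \<subseteq> X" "card H = card X - t"
    using cross H(1) by (auto simp: crossing_hypergraph_def uniform_hypergraph_def)
  have "card H \<le> card {C \<in> P. H \<inter> C \<noteq> {}}"
    using H(2) HX(2) \<open>card P = card X - s\<close> s by (simp add: edge_crosses_def)
  note one = crossed_class_card_le[OF X part HX(1) this]
  \<comment> \<open>Each part has two elements and at most one of them lies in \<open>H\<close>.\<close>
  have "\<forall>i<s. \<exists>x. x \<in> pr i - H"
  proof (intro allI impI, rule ccontr)
    fix i assume i: "i < s" and "\<not> (\<exists>x. x \<in> pr i - H)"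
    then have "H \<inter> pr i = pr i" by auto
    then show False using one[of "pr i"] i pr_card[OF i] by (auto simp: P_def)
  qed
  then obtain c where "\<And>i. i < s \<Longrightarrow> c i \<in> pr i - H" by metis
  then show False using choice[of c] H(1) by blast
qed

text \<open>
  Listing each avoided set in increasing order turns the family into a set of tuples of the same
  cardinality; passing from sets to tuples this way loses only a constant factor in the density.
\<close>

lemma few_avoided_sets:
  fixes \<gamma> :: real
  assumes s: "s \<le> t" and \<gamma>: "0 < \<gamma>"
  shows "\<exists>n\<^sub>0. \<forall>(X :: 'a :: linorder set) \<H>. finite X \<and> n\<^sub>0 \<le> card X \<and>
      crossing_hypergraph X (card X - s) (card X - t) \<H>
    \<longrightarrow> real (card {u \<in> subsets_of_card s X. \<forall>H\<in>\<H>. u \<inter> H \<noteq> {}}) \<le> \<gamma> * real (card X) ^ s"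
proof -
  from complete_partite_box[OF \<gamma>, of s] obtain m where box: "\<forall>(X :: 'a set) R. finite X \<and> m \<le> card X \<and>
      R \<subseteq> {xs. set xs \<subseteq> X \<and> length xs = s} \<and> \<gamma> * real (card X) ^ s \<le> real (card R)
    \<longrightarrow> (\<exists>ps. length ps = s \<and> (\<forall>(a, b)\<in>set ps. a \<noteq> b) \<and>
      (\<forall>xs. list_all2 (\<lambda>x (a, b). x = a \<or> x = b) xs ps \<longrightarrow> xs \<in> R))"
    by (elim exE) (rule that)
  have step: "real (card {u \<in> subsets_of_card s X. \<forall>H\<in>\<H>. u \<inter> H \<noteq> {}}) \<le> \<gamma> * real (card X) ^ s"
    if X: "finite X" and m: "m \<le> card X"
      and cross: "crossing_hypergraph X (card X - s) (card X - t) \<H>" for X :: "'a set" and \<H>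
  proof (rule ccontr)
    let ?U = "{u \<in> subsets_of_card s X. \<forall>H\<in>\<H>. u \<inter> H \<noteq> {}}"
    let ?R = "sorted_list_of_set ` ?U"
    assume "\<not> ?thesis"
    then have big: "\<gamma> * real (card X) ^ s \<le> real (card ?U)" by simp
    have fin: "finite u" if "u \<in> ?U" for u
      using that X finite_subset by (auto simp: subsets_of_card_def)
    have "inj_on sorted_list_of_set ?U"
    proof (rule inj_onI)
      fix u v assume uv: "u \<in> ?U" "v \<in> ?U" and eq: "sorted_list_of_set u = sorted_list_of_set v"
      show "u = v"
        using arg_cong[OF eq, of set] fin[OF uv(1)] fin[OF uv(2)] by simp
    qed
    then have "card ?R = card ?U" by (rule card_image)
    then have dense: "\<gamma> * real (card X) ^ s \<le> real (card ?R)" using big by simp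
    have "?R \<subseteq> {xs. set xs \<subseteq> X \<and> length xs = s}"
    proof (rule image_subsetI)
      fix u assume u: "u \<in> ?U"
      then show "sorted_list_of_set u \<in> {xs. set xs \<subseteq> X \<and> length xs = s}"
        using fin[OF u] by (simp add: subsets_of_card_def)
    qed
    from box[rule_format, OF conjI[OF X conjI[OF m conjI[OF this dense]]]]
    obtain ps where ps: "length ps = s" "\<forall>(a, b)\<in>set ps. a \<noteq> b"
      "\<And>xs. list_all2 (\<lambda>x (a, b). x = a \<or> x = b) xs ps \<Longrightarrow> xs \<in> ?R"
      by (elim exE conjE) (rule that; blast)
    show False
    proof (rule no_box_avoids_complements[OF cross X s ps(1,2)])
      fix xs assume "list_all2 (\<lambda>x (a, b). x = a \<or> x = b) xs ps"
      then obtain u where u: "u \<in> ?U" "xs = sorted_list_of_set u" using ps(3) by blast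
      then show "distinct xs \<and> set xs \<subseteq> X \<and> (\<forall>H\<in>\<H>. set xs \<inter> H \<noteq> {})"
        using fin[OF u(1)] by (simp add: subsets_of_card_def)
    qed
  qed
  show ?thesis
    by (intro exI[of _ m] allI impI, elim conjE) (rule step; assumption)
qed

lemma choose_le_crossing:
  assumes cross: "crossing_hypergraph X (card X - s) (card X - t) \<H>" and X: "finite X" and t: "t \<le> card X"
  shows "card X choose s \<le> card {u \<in> subsets_of_card s X. \<forall>H\<in>\<H>. u \<inter> H \<noteq> {}} + card \<H> * (t choose s)"
proof -
  let ?U = "{u \<in> subsets_of_card s X. \<forall>H\<in>\<H>. u \<inter> H \<noteq> {}}"
  have \<H>: "H \<subseteq> X \<and> card H = card X - t" if "H \<in> \<H>" for H
    using cross that by (auto simp: crossing_hypergraph_def uniform_hypergraph_def)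
  have fin\<H>: "finite \<H>" by (rule finite_subset[of _ "Pow X"]) (use \<H> X in auto)
  have each: "card (subsets_of_card s (X - H)) = t choose s" if "H \<in> \<H>" for H
  proof -
    have "card (X - H) = t" using \<H>[OF that] t X by (auto simp: card_Diff_subset finite_subset)
    then show ?thesis using card_subsets_of_card[of "X - H" s] X by simp
  qed
  have fin: "finite (subsets_of_card s Y)" if "finite Y" for Y :: "'a set"
    using that by (auto simp: subsets_of_card_def)
  have "card X choose s = card (subsets_of_card s X)" using card_subsets_of_card[OF X] by simp
  also have "\<dots> \<le> card (?U \<union> (\<Union>H\<in>\<H>. subsets_of_card s (X - H)))"
    by (rule card_mono) (use fin fin\<H> X in \<open>auto simp: subsets_of_card_def\<close>)
  also have "\<dots> \<le> card ?U + card (\<Union>H\<in>\<H>. subsets_of_card s (X - H))" by (rule card_Un_le)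
  also have "\<dots> \<le> card ?U + (\<Sum>H\<in>\<H>. card (subsets_of_card s (X - H)))"
    by (intro add_left_mono card_UN_le[OF fin\<H>])
  also have "(\<Sum>H\<in>\<H>. card (subsets_of_card s (X - H))) = card \<H> * (t choose s)"
    using each by simp
  finally show ?thesis .
qed

lemma min_crossing_lower:
  fixes \<eta> :: real
  assumes s: "s \<le> t" and \<eta>: "0 < \<eta>"
  shows "\<forall>\<^sub>F n in at_top. (1 - \<eta>) * real (n choose s) \<le> real (min_crossing n (n - s) (n - t)) * real (t choose s)"
proof -
  define \<gamma> where "\<gamma> = \<eta> / real s ^ s"
  have ss: "0 < real s ^ s" by (cases "s = 0") auto
  then have \<gamma>: "0 < \<gamma>" using \<eta> by (simp add: \<gamma>_def)
  from few_avoided_sets[OF s \<gamma>] obtain m where few: "\<forall>(X :: nat set) \<H>. finite X \<and> m \<le> card X \<and>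
      crossing_hypergraph X (card X - s) (card X - t) \<H>
    \<longrightarrow> real (card {u \<in> subsets_of_card s X. \<forall>H\<in>\<H>. u \<inter> H \<noteq> {}}) \<le> \<gamma> * real (card X) ^ s"
    by (elim exE) (rule that)
  show ?thesis
    using eventually_ge_at_top[of "max m t"]
  proof eventually_elim
    case (elim n)
    obtain \<H> where \<H>: "crossing_hypergraph {..<n} (n - s) (n - t) \<H>" "card \<H> = min_crossing n (n - s) (n - t)"
      using min_crossing_attained[of "n - t" n "n - s"] by auto
    let ?U = "{u \<in> subsets_of_card s {..<n}. \<forall>H\<in>\<H>. u \<inter> H \<noteq> {}}"
    have "real (card ?U) \<le> \<gamma> * real n ^ s"
      using few[rule_format, of "{..<n}" \<H>] \<H>(1) elim by simp
    also have "\<dots> = \<eta> * (real n / real s) ^ s" by (simp add: \<gamma>_def power_divide)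
    also have "\<dots> \<le> \<eta> * real (n choose s)"
      using binomial_ge_n_over_k_pow_k[of s n, where ?'a = real] elim s \<eta> by (intro mult_left_mono) auto
    finally have U: "real (card ?U) \<le> \<eta> * real (n choose s)" .
    have "n choose s \<le> card ?U + card \<H> * (t choose s)"
      using choose_le_crossing[of "{..<n}" s t \<H>] \<H>(1) elim by simp
    then have "real (n choose s) \<le> real (card ?U) + real (card \<H>) * real (t choose s)"
      by (simp only: of_nat_le_iff flip: of_nat_mult of_nat_add)
    then show ?case using U \<H>(2) by (simp add: algebra_simps)
  qed
qed

lemma min_crossing_upper:
  fixes \<eta> :: real
  assumes s: "s \<le> t" and \<eta>: "0 < \<eta>"
  shows "\<forall>\<^sub>F n in at_top. real (min_crossing n (n - s) (n - t)) * real (t choose s) \<le> (1 + \<eta>) * real (n choose s)"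
proof -
  have ts: "0 < real (t choose s)" using s by simp
  define \<gamma> where "\<gamma> = \<eta> / real (t choose s)"
  have \<gamma>: "0 < \<gamma>" using ts \<eta> by (simp add: \<gamma>_def)
  from roedl_covering[OF s \<gamma>] obtain m where cover: "\<forall>X :: nat set. finite X \<and> m \<le> card X \<longrightarrow>
    (\<exists>\<T> \<subseteq> subsets_of_card t X. (\<forall>u\<in>subsets_of_card s X. \<exists>T\<in>\<T>. u \<subseteq> T) \<and>
      real (card \<T>) \<le> (1 / real (t choose s) + \<gamma>) * real (card X choose s))"
    by (elim exE) (rule that)
  show ?thesis
    using eventually_ge_at_top[of "max m t"]
  proof eventually_elim
    case (elim n)
    obtain \<T> where \<T>: "\<T> \<subseteq> subsets_of_card t {..<n}" "\<And>u. u \<in> subsets_of_card s {..<n} \<Longrightarrow> \<exists>T\<in>\<T>. u \<subseteq> T"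
      and card: "real (card \<T>) \<le> (1 / real (t choose s) + \<gamma>) * real (n choose s)"
      using cover[rule_format, of "{..<n}"] elim by auto
    have "min_crossing n (n - s) (n - t) \<le> card \<T>"
      by (rule min_crossing_le_cover[OF s _ \<T>]) (use elim in auto)
    then have "real (min_crossing n (n - s) (n - t)) \<le> (1 / real (t choose s) + \<gamma>) * real (n choose s)"
      using card by linarith
    then have "real (min_crossing n (n - s) (n - t)) * real (t choose s)
        \<le> (1 / real (t choose s) + \<gamma>) * real (n choose s) * real (t choose s)"
      by (rule mult_right_mono) simp
    also have "\<dots> = (1 + \<eta>) * real (n choose s)" using ts by (simp add: \<gamma>_def field_simps)
    finally show ?case .
  qed
qed

theorem theorem16:
  fixes s t :: nat
  assumes "s \<le> t"
  shows "(\<lambda>n. real (min_crossing n (n - s) (n - t))) \<sim>[at_top]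
         (\<lambda>n. real (n choose s) / real (t choose s))"
proof (rule asymp_equivI', rule tendstoI)
  let ?f = "\<lambda>n. real (min_crossing n (n - s) (n - t))"
  fix r :: real assume r: "0 < r"
  then have "0 < r / 2" by simp
  note bounds = min_crossing_lower[OF assms this] min_crossing_upper[OF assms this]
  show "\<forall>\<^sub>F n in at_top. dist (?f n / (real (n choose s) / real (t choose s))) 1 < r"
    using bounds eventually_ge_at_top[of s]
  proof eventually_elim
    case (elim n)
    let ?q = "?f n / (real (n choose s) / real (t choose s))"
    have pos: "0 < real (n choose s)" using elim by simp
    have "?q = ?f n * real (t choose s) / real (n choose s)" by simp
    then have "1 - r / 2 \<le> ?q" "?q \<le> 1 + r / 2"
      using elim pos by (simp_all add: pos_le_divide_eq pos_divide_le_eq)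
    then show ?case using r by (simp add: dist_real_def abs_less_iff)
  qed
qed

end
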